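(* There is a positive universal constant $\delta_0$ such that the following holds. Let $X_1, X_2, \dots$ be i.i.d. symmetric real random variables satisfying $$\big\||X_1|-1\big\|_2 \leq \delta_0 .$$ Then for every $n \geq 3$ and every unit vector $a=(a_1,\dots,a_n)$ in $\mathbb{R}^n$ with $\|a\|_\infty \leq \frac{1}{\sqrt{2}}$, we have $$\mathbb{E}\left|\sum_{j=1}^n a_jX_j\right| \geq \mathbb{E}\left|\frac{X_1+X_2}{\sqrt{2}}\right|.$$ Moreover, one can take $\delta_0 = 10^{-4}$.
   Context: For a real random variable $Y$, $\|Y\|_2 = (\mathbb{E}|Y|^2)^{1/2}$. For $a \in \mathbb{R}^n$, $\|a\|_\infty = \max_{j\le n}|a_j|$; "unit vector" means $\sum_j a_j^2 = 1$. A random variable $X$ is symmetric if $-X$ has the same distribution as $X$. *)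

theory Defs
  imports "HOL-Probability.Probability"
begin

definition iid_seq :: "'a measure \<Rightarrow> (nat \<Rightarrow> 'a \<Rightarrow> real) \<Rightarrow> bool" where
  "iid_seq M X \<longleftrightarrow>
     prob_space.indep_vars M (\<lambda>_. borel) X {1..} \<and>
     (\<forall>j\<ge>1. distr M borel (X j) = distr M borel (X 1))"

definition symmetric_rv :: "'a measure \<Rightarrow> ('a \<Rightarrow> real) \<Rightarrow> bool" where
  "symmetric_rv M Y \<longleftrightarrow>
     Y \<in> borel_measurable M \<and> distr M borel (\<lambda>\<omega>. - Y \<omega>) = distr M borel Y"

text \<open>The Bochner integral of a non-integrable function is 0, so a bound on \<open>L2_norm M Y\<close> is
  meaningful only together with integrability of \<open>\<bar>Y\<bar>\<^sup>2\<close>.\<close>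

definition L2_norm :: "'a measure \<Rightarrow> ('a \<Rightarrow> real) \<Rightarrow> real" where
  "L2_norm M Y = sqrt (\<integral>\<omega>. \<bar>Y \<omega>\<bar>\<^sup>2 \<partial>M)"

definition L2_norm_le :: "'a measure \<Rightarrow> ('a \<Rightarrow> real) \<Rightarrow> real \<Rightarrow> bool" where
  "L2_norm_le M Y \<delta> \<longleftrightarrow> integrable M (\<lambda>\<omega>. \<bar>Y \<omega>\<bar>\<^sup>2) \<and> L2_norm M Y \<le> \<delta>"

text \<open>Vectors in \<open>\<real>\<^sup>n\<close> are functions on \<open>nat\<close>, of which only the values on
  \<open>{1..n}\<close> matter.\<close>

definition unit_vec :: "nat \<Rightarrow> (nat \<Rightarrow> real) \<Rightarrow> bool" where
  "unit_vec n a \<longleftrightarrow> (\<Sum>j=1..n. (a j)\<^sup>2) = 1"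

definition sup_norm :: "nat \<Rightarrow> (nat \<Rightarrow> real) \<Rightarrow> real" where
  "sup_norm n a = Max ((\<lambda>j. \<bar>a j\<bar>) ` {1..n})"

text \<open>The constant \<open>\<delta>\<close> works for all i.i.d. sequences on all probability spaces over the type
  \<open>'a\<close>; the type argument is needed only because \<open>'a\<close> does not occur in \<open>\<delta>\<close>.\<close>

definition admissible_constant :: "'a itself \<Rightarrow> real \<Rightarrow> bool" where
  "admissible_constant (_ :: 'a itself) \<delta> \<longleftrightarrow>
     (\<forall>(M :: 'a measure) X.
        prob_space M \<longrightarrow> iid_seq M X \<longrightarrow> symmetric_rv M (X 1) \<longrightarrow>
        L2_norm_le M (\<lambda>\<omega>. \<bar>X 1 \<omega>\<bar> - 1) \<delta> \<longrightarrow>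
        (\<forall>n\<ge>3. \<forall>a. unit_vec n a \<longrightarrow> sup_norm n a \<le> 1 / sqrt 2 \<longrightarrow>
           (\<integral>\<omega>. \<bar>\<Sum>j=1..n. a j * X j \<omega>\<bar> \<partial>M)
             \<ge> (\<integral>\<omega>. \<bar>(X 1 \<omega> + X 2 \<omega>) / sqrt 2\<bar> \<partial>M)))"

end

theory Submission
  imports Defs "HOL-Real_Asymp.Real_Asymp"
begin

text \<open>Write \<open>\<delta> = 10\<^sup>-\<^sup>4\<close> and call a coefficient large if its modulus exceeds \<open>3/5\<close>.

  If at most one coefficient is large, replacing \<open>\<bar>X\<^sub>j\<bar>\<close> by \<open>1\<close> costs at most \<open>\<delta>\<close>, and the Rademacher
  average \<open>E \<bar>\<Sum> a\<^sub>j \<epsilon>\<^sub>j\<bar>\<close> exceeds \<open>1/\<surd>2\<close> by much more than that. This is Haagerup's argument: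
  \<open>\<bar>x\<bar> = 2/\<pi> \<integral> (1 - cos (x t))/t\<^sup>2 dt\<close>, the weighted inequality of the means separates the factors of
  \<open>\<Prod> cos (a\<^sub>j t)\<close>, and the remaining one-variable integrals are the Wallis integrals
  \<open>W(s) = \<integral> cos\<^sup>s\<close> at \<open>s = 1/a\<^sub>j\<^sup>2\<close>, bounded below through \<open>(s + 1) W(s) W(s + 1) = \<pi>/2\<close> and
  log-convexity.

  If two coefficients \<open>x, y\<close> are large, let \<open>Y\<close> be the remaining sum and \<open>\<tau> = 1 - x\<^sup>2 - y\<^sup>2\<close>. Averaging over
  the signs of the three parts, it is enough to bound \<open>E max(\<bar>x R - y R'\<bar>, \<bar>Y\<bar>)\<close> from below, where
  \<open>R, R'\<close> are two independent copies of \<open>\<bar>X\<^sub>1\<bar>\<close>. The loss against the extremal vector is of order \<open>\<tau>\<close>,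
  whereas \<open>E \<bar>Y\<bar>\<close> is of order \<open>\<surd>\<tau>\<close>. This settles the case \<open>\<surd>\<tau> \<ge> 10 \<delta>\<close>; for smaller \<open>\<tau>\<close> the gain comes
  from the event \<open>\<bar>R - R'\<bar> \<le> w\<close>, \<open>w\<close> of order \<open>\<surd>\<tau>\<close>, whose probability is at least of order \<open>w/\<delta>\<close>
  because \<open>R\<close> is concentrated at scale \<open>\<delta>\<close>.\<close>

section \<open>The cosine representation of the absolute value\<close>

text \<open>Integration by parts of \<open>(1 - cos t) / t\<^sup>2\<close>: the boundary part is
  \<open>- (1 - cos t) / t\<close>, and the remaining integrand \<open>sin t / t\<close> is that of
  \<open>Si\<close>.\<close>

lemma DERIV_Si_minus:
  assumes "t > 0"
  shows "((\<lambda>t. Si t - (1 - cos t) / t) has_real_derivative (1 - cos t) / t\<^sup>2) (at t)"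
  using assms
  by (auto intro!: derivative_eq_intros DERIV_Si simp: field_simps power2_eq_square)

lemma Si_minus_mono:
  assumes "0 < t" "t \<le> u"
  shows "Si t - (1 - cos t) / t \<le> Si u - (1 - cos u) / u"
proof (rule DERIV_nonneg_imp_nondecreasing[OF assms(2)])
  fix x assume "t \<le> x" "x \<le> u"
  then show "\<exists>y. ((\<lambda>t. Si t - (1 - cos t) / t) has_real_derivative y) (at x) \<and> 0 \<le> y"
    using assms(1) by (intro exI[of _ "(1 - cos x) / x\<^sup>2"] conjI DERIV_Si_minus) auto
qed

text \<open>The function is nondecreasing on the positive axis, tends to 0 at 0 and to
  \<open>pi / 2\<close> at infinity.\<close>

lemma Si_minus_bounds:
  assumes t: "0 < t"
  shows "0 \<le> Si t - (1 - cos t) / t" "Si t - (1 - cos t) / t \<le> pi / 2"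
proof -
  have "((\<lambda>u::real. (1 - cos u) / u) \<longlongrightarrow> 0) at_top" by real_asymp
  then have "((\<lambda>u. Si u - (1 - cos u) / u) \<longlongrightarrow> pi / 2 - 0) at_top"
    by (intro tendsto_diff Si_at_top)
  moreover have "eventually (\<lambda>u. Si t - (1 - cos t) / t \<le> Si u - (1 - cos u) / u) at_top"
    using eventually_ge_at_top[of t] by eventually_elim (rule Si_minus_mono[OF t])
  ultimately show "Si t - (1 - cos t) / t \<le> pi / 2"
    using tendsto_lowerbound by fastforce
  have "Si 0 = 0" by (simp add: Si_def zero_ereal_def[symmetric])
  then have "(Si \<longlongrightarrow> 0) (at_right 0)"
    using isCont_Si[of 0] by (auto simp: isCont_def intro: tendsto_mono[OF at_le])
  moreover have "((\<lambda>u::real. (1 - cos u) / u) \<longlongrightarrow> 0) (at_right 0)" by real_asymp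
  ultimately have "((\<lambda>u. Si u - (1 - cos u) / u) \<longlongrightarrow> 0 - 0) (at_right 0)"
    by (intro tendsto_diff)
  moreover have "eventually (\<lambda>u. Si u - (1 - cos u) / u \<le> Si t - (1 - cos t) / t) (at_right 0)"
    using eventually_at_right_less[of 0] eventually_at_right_real[OF t]
    by eventually_elim (intro Si_minus_mono, auto)
  ultimately show "0 \<le> Si t - (1 - cos t) / t"
    using tendsto_upperbound by fastforce
qed

text \<open>The upper half of the cosine representation, on a compact range. Substituting
  \<open>y * t\<close> with \<open>y = \<bar>x\<bar>\<close> turns the integral into
  \<open>y\<close> times an increment of a function with values between 0 and
  \<open>pi / 2\<close>.\<close>

lemma integral_cos_le_abs:
  fixes x :: real
  assumes e: "0 < e" "e \<le> T"
  shows "integral {e..T} (\<lambda>t. (1 - cos (x * t)) / t\<^sup>2) \<le> pi / 2 * \<bar>x\<bar>"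
proof (cases "x = 0")
  case False
  define y where "y = \<bar>x\<bar>"
  have y: "y > 0" using False by (simp add: y_def)
  have c: "cos (x * t) = cos (y * t)" for t
    by (simp add: y_def abs_if)
  define F where "F t = Si t - (1 - cos t) / t" for t
  have "((\<lambda>t. (1 - cos (y * t)) / t\<^sup>2) has_integral (y * F (y * T) - y * F (y * e))) {e..T}"
  proof (rule fundamental_theorem_of_calculus[OF e(2)])
    fix t assume "t \<in> {e..T}"
    then have t: "t > 0" using e by auto
    have "((\<lambda>t. y * F (y * t)) has_real_derivative y * ((1 - cos (y * t)) / (y * t)\<^sup>2 * y)) (at t)"
      unfolding F_def
      by (rule DERIV_cmult, rule DERIV_chain'[OF _ DERIV_Si_minus]) (use y t in \<open>auto intro!: derivative_eq_intros\<close>)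
    also have "y * ((1 - cos (y * t)) / (y * t)\<^sup>2 * y) = (1 - cos (y * t)) / t\<^sup>2"
      using y t by (simp add: field_simps power2_eq_square)
    finally show "((\<lambda>t. y * F (y * t)) has_vector_derivative (1 - cos (y * t)) / t\<^sup>2) (at t within {e..T})"
      by (simp add: has_real_derivative_iff_has_vector_derivative has_vector_derivative_at_within)
  qed
  then have "integral {e..T} (\<lambda>t. (1 - cos (x * t)) / t\<^sup>2) = y * F (y * T) - y * F (y * e)"
    by (simp add: c integral_unique)
  also have "\<dots> \<le> y * (pi / 2) - y * 0"
    using Si_minus_bounds[of "y * T"] Si_minus_bounds[of "y * e"] y e
    by (intro diff_mono mult_left_mono) (auto simp: F_def)
  finally show ?thesis by (simp add: y_def mult.commute)
qed simp

section \<open>Wallis integrals with real exponents\<close>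

text \<open>In terms of the Gamma function this is sqrt(pi)/2 * Gamma((s+1)/2) / Gamma(s/2 + 1) for
  \<open>s > 0\<close>. A real exponent is required because it is later taken to be
  \<open>1 / (a j)\<^sup>2\<close>.\<close>

definition wallis :: "real \<Rightarrow> real" where
  "wallis s = integral {0..pi/2} (\<lambda>x. cos x powr s)"

lemma cos_nonneg_pi_half: "x \<in> {0..pi/2} \<Longrightarrow> 0 \<le> cos x"
  by (auto intro: cos_ge_zero)

lemma continuous_on_cos_powr:
  assumes "s > 0"
  shows "continuous_on {0..pi/2} (\<lambda>x. cos x powr s)"
  using assms by (intro continuous_on_powr' continuous_intros) (auto intro: cos_ge_zero)

lemma wallis_mono:
  assumes "0 < s" "s \<le> t"
  shows "wallis t \<le> wallis s"
  unfolding wallis_def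
proof (rule integral_le)
  fix x :: real assume "x \<in> {0..pi/2}"
  then show "cos x powr t \<le> cos x powr s"
    using powr_mono'[of s t "cos x"] assms cos_nonneg_pi_half[of x] cos_le_one[of x] by blast
qed (use assms in \<open>auto intro!: integrable_continuous_interval continuous_on_cos_powr\<close>)

lemma wallis_nonneg: "0 \<le> wallis s"
proof (cases "(\<lambda>x. cos x powr s) integrable_on {0..pi/2}")
  case True then show ?thesis unfolding wallis_def by (rule integral_nonneg) auto
next
  case False then show ?thesis by (simp add: wallis_def not_integrable_integral)
qed

lemma wallis_1: "wallis 1 = 1"
proof -
  have "((\<lambda>x. cos x) has_integral (sin (pi/2) - sin 0)) {0..pi/2}"
    by (rule fundamental_theorem_of_calculus)
       (auto intro!: derivative_eq_intros simp: has_real_derivative_iff_has_vector_derivative[symmetric])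
  moreover have "((\<lambda>x. cos x powr 1) has_integral 1) {0..pi/2} \<longleftrightarrow> (cos has_integral 1) {0..pi/2}"
    using cos_nonneg_pi_half by (intro has_integral_cong) simp
  ultimately have "((\<lambda>x. cos x powr 1) has_integral 1) {0..pi/2}"
    by simp
  then show ?thesis by (simp add: wallis_def integral_unique)
qed

lemma wallis_2: "wallis 2 = pi / 4"
proof -
  have "((\<lambda>x. cos x ^ 2) has_integral ((pi/2 + sin (pi/2) * cos (pi/2)) / 2 - (0 + sin 0 * cos 0) / 2)) {0..pi/2}"
  proof (rule fundamental_theorem_of_calculus)
    fix x :: real
    have "(1 + (cos x * cos x - sin x * sin x)) / 2 = cos x ^ 2"
      using sin_cos_squared_add[of x] by (simp add: power2_eq_square field_simps)
    then have "((\<lambda>x. (x + sin x * cos x) / 2) has_real_derivative (cos x ^ 2)) (at x within {0..pi/2})"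
      by (auto intro!: derivative_eq_intros simp: algebra_simps)
    then show "((\<lambda>x. (x + sin x * cos x) / 2) has_vector_derivative (cos x ^ 2)) (at x within {0..pi/2})"
      by (simp add: has_real_derivative_iff_has_vector_derivative)
  qed simp
  moreover have "((\<lambda>x. cos x powr 2) has_integral (pi/4)) {0..pi/2}
      \<longleftrightarrow> ((\<lambda>x. cos x ^ 2) has_integral (pi/4)) {0..pi/2}"
    using cos_nonneg_pi_half by (intro has_integral_cong) (simp add: powr_numeral)
  ultimately have "((\<lambda>x. cos x powr 2) has_integral (pi/4)) {0..pi/2}"
    by simp
  then show ?thesis by (simp add: wallis_def integral_unique)
qed

text \<open>The integrand of the difference of the two sides is the derivative of
  \<open>cos x powr (s + 1) * sin x\<close>, which vanishes at both end points.\<close>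

lemma wallis_rec:
  assumes s: "s > 0"
  shows "(s + 2) * wallis (s + 2) = (s + 1) * wallis s"
proof -
  let ?f = "\<lambda>x. cos x powr (s + 1) * sin x"
  let ?f' = "\<lambda>x. (s + 2) * cos x powr (s + 2) - (s + 1) * cos x powr s"
  have "(?f' has_integral (?f (pi/2) - ?f 0)) {0..pi/2}"
  \<comment> \<open>The derivative rule for \<open>powr\<close> requires \<open>cos x > 0\<close>,
    which fails at \<open>pi / 2\<close>.\<close>
  proof (rule fundamental_theorem_of_calculus_interior)
    show "continuous_on {0..pi/2} ?f"
      using s by (intro continuous_intros continuous_on_cos_powr) auto
    fix x :: real assume x: "x \<in> {0<..<pi/2}"
    then have c: "cos x > 0" by (auto intro: cos_gt_zero)
    have "(?f has_real_derivative (cos x powr (s + 1) * cos x + (s + 1) * cos x powr s * (- sin x) * sin x)) (at x)"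
      using c by (auto intro!: derivative_eq_intros)
    also have "cos x powr (s + 1) * cos x + (s + 1) * cos x powr s * (- sin x) * sin x
      = cos x powr s * (cos x * cos x) - (s + 1) * cos x powr s * (sin x * sin x)"
      using c by (simp add: powr_add)
    also have "sin x * sin x = 1 - cos x * cos x"
      using sin_squared_eq[of x] by (simp add: power2_eq_square)
    also have "cos x powr s * (cos x * cos x) - (s + 1) * cos x powr s * (1 - cos x * cos x) = ?f' x"
      using c by (simp add: powr_add powr_numeral power2_eq_square algebra_simps)
    finally show "(?f has_vector_derivative ?f' x) (at x)"
      by (simp add: has_real_derivative_iff_has_vector_derivative)
  qed simp
  then have "integral {0..pi/2} ?f' = 0"
    by (simp add: integral_unique)
  moreover have "integral {0..pi/2} ?f' = (s + 2) * wallis (s + 2) - (s + 1) * wallis s"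
    unfolding wallis_def using s
    by (subst integral_diff) (auto intro!: integrable_continuous_interval continuous_intros continuous_on_cos_powr)
  ultimately show ?thesis by simp
qed

text \<open>The recursion carries positivity from 2 to all even exponents, and monotonicity covers
  the exponents below them.\<close>

lemma wallis_pos:
  assumes s: "s > 0"
  shows "wallis s > 0"
proof -
  have *: "wallis (2 + 2 * real n) > 0" for n
  proof (induction n)
    case (Suc n)
    have "(2 + 2 * real n + 2) * wallis (2 + 2 * real n + 2) = (2 + 2 * real n + 1) * wallis (2 + 2 * real n)"
      by (intro wallis_rec) auto
    moreover have "(2 + 2 * real n + 1) * wallis (2 + 2 * real n) > 0"
      using Suc by (intro mult_pos_pos) auto
    ultimately have "wallis (2 + 2 * real n + 2) > 0"
      by (smt (verit) zero_less_mult_iff of_nat_0_le_iff)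
    then show ?case by (simp add: algebra_simps)
  qed (simp add: wallis_2)
  obtain n where "real n > s" using reals_Archimedean2 by blast
  then have "wallis (2 + 2 * real n) \<le> wallis s"
    using s by (intro wallis_mono) auto
  then show ?thesis using *[of n] by linarith
qed

text \<open>By the recursion, \<open>(s + 1) * wallis s * wallis (s + 1)\<close> has period 1 in
  \<open>s\<close>; its value at integers then follows from \<open>s = 1\<close>.\<close>

lemma wallis_product_period:
  assumes "s > 0"
  shows "(s + 1 + real n) * wallis (s + real n) * wallis (s + 1 + real n) = (s + 1) * wallis s * wallis (s + 1)"
proof (induction n)
  case (Suc n)
  have "(s + real n + 2) * wallis (s + real n + 2) = (s + real n + 1) * wallis (s + real n)"
    using assms by (intro wallis_rec) auto
  note rec = this
  have "(s + 1 + real (Suc n)) * wallis (s + real (Suc n)) * wallis (s + 1 + real (Suc n))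
      = wallis (s + 1 + real n) * ((s + real n + 2) * wallis (s + real n + 2))"
    by (simp add: add_ac mult_ac)
  also have "\<dots> = (s + 1 + real n) * wallis (s + real n) * wallis (s + 1 + real n)"
    by (subst rec) (simp add: add_ac mult_ac)
  finally show ?case using Suc by simp
qed simp

lemma wallis_product_nat: "real (n + 2) * wallis (real (n + 1)) * wallis (real (n + 2)) = pi / 2"
  using wallis_product_period[of 1 n] by (simp add: wallis_1 wallis_2 algebra_simps)

text \<open>By periodicity \<open>s\<close> may be replaced by \<open>s + n\<close>. Monotonicity
  compares that product with the one at the next integer, whose value is \<open>pi / 2\<close>; the
  ratio of the prefactors tends to 1.\<close>

lemma wallis_product_ge:
  assumes s: "s > 0"
  shows "(s + 1) * wallis s * wallis (s + 1) \<ge> pi / 2"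
proof -
  let ?Q = "(s + 1) * wallis s * wallis (s + 1)"
  have "eventually (\<lambda>n. (s + 1 + real n) / (s + 3 + real n) * (pi / 2) \<le> ?Q) sequentially"
  proof (rule eventually_sequentiallyI)
    fix n assume "0 \<le> (n::nat)"
    define N where "N = nat \<lfloor>s + real n\<rfloor>"
    have N: "real N \<le> s + real n" "s + real n \<le> real (N + 1)"
      using s unfolding N_def by linarith+
    have "(s + 1 + real n) / (s + 3 + real n) * (pi / 2)
        \<le> (s + 1 + real n) / real (N + 2) * (pi / 2)"
      using N s by (intro mult_right_mono divide_left_mono) auto
    also have "\<dots> = (s + 1 + real n) * (wallis (real (N + 1)) * wallis (real (N + 2)))"
      using wallis_product_nat[of N] by (simp add: field_simps)
    also have "\<dots> \<le> (s + 1 + real n) * (wallis (s + real n) * wallis (s + 1 + real n))"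
      using N s by (intro mult_left_mono mult_mono wallis_mono wallis_nonneg) auto
    also have "\<dots> = ?Q" using wallis_product_period[OF s, of n] by (simp add: mult.assoc)
    finally show "(s + 1 + real n) / (s + 3 + real n) * (pi / 2) \<le> ?Q" .
  qed
  moreover have "(\<lambda>n. (s + 1 + real n) / (s + 3 + real n) * (pi / 2)) \<longlonglongrightarrow> pi / 2"
    by real_asymp
  ultimately show ?thesis
    using tendsto_upperbound by fastforce
qed

lemma wallis_log_convex:
  assumes s: "s > 0"
  shows "(wallis (s + 1))\<^sup>2 \<le> wallis s * wallis (s + 2)"
proof -
  \<comment> \<open>The minimiser of the quadratic \<open>l\<^sup>2 * wallis s - 2 * l * wallis (s +
    1) + wallis (s + 2)\<close>, which is the integral of
    \<open>cos x powr s * (l - cos x)\<^sup>2\<close>; this is Cauchy-Schwarz.\<close>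
  define l where "l = wallis (s + 1) / wallis s"
  have W: "wallis s > 0" using s by (rule wallis_pos)
  have "0 \<le> integral {0..pi/2} (\<lambda>x. l\<^sup>2 * cos x powr s - 2 * l * cos x powr (s + 1) + cos x powr (s + 2))"
  proof (rule integral_nonneg)
    fix x :: real assume "x \<in> {0..pi/2}"
    then have c: "0 \<le> cos x" by (auto intro: cos_ge_zero)
    have "l\<^sup>2 * cos x powr s - 2 * l * cos x powr (s + 1) + cos x powr (s + 2) = cos x powr s * (l - cos x)\<^sup>2"
      using c s by (cases "cos x = 0") (auto simp: powr_add powr_numeral power2_eq_square algebra_simps)
    then show "0 \<le> l\<^sup>2 * cos x powr s - 2 * l * cos x powr (s + 1) + cos x powr (s + 2)"
      by simp
  qed (use s in \<open>auto intro!: integrable_continuous_interval continuous_intros continuous_on_cos_powr\<close>)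
  also have "\<dots> = l\<^sup>2 * wallis s - 2 * l * wallis (s + 1) + wallis (s + 2)"
    unfolding wallis_def using s
    by (subst integral_add integral_diff; (subst integral_diff)?)
       (auto intro!: integrable_continuous_interval continuous_intros continuous_on_cos_powr)
  also have "\<dots> = wallis (s + 2) - (wallis (s + 1))\<^sup>2 / wallis s"
    using W by (simp add: l_def field_simps power2_eq_square)
  finally show ?thesis using W by (simp add: field_simps)
qed

text \<open>Log-convexity and the recursion bound \<open>wallis (s + 1)\<close> by a multiple of
  \<open>wallis s\<close>; inserting this into the squared product bound leaves only
  \<open>wallis s\<close>.\<close>

lemma wallis_lower:
  assumes s: "s > 0"
  shows "wallis s ^ 4 \<ge> pi\<^sup>2 / 4 * (s + 2) / (s + 1) ^ 3"
proof -
  have W: "wallis s > 0" "wallis (s + 1) > 0" using s by (auto intro: wallis_pos)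
  have "wallis (s + 2) = (s + 1) / (s + 2) * wallis s"
    using wallis_rec[OF s] s by (simp add: field_simps)
  then have "(wallis (s + 1))\<^sup>2 \<le> wallis s * ((s + 1) / (s + 2) * wallis s)"
    using wallis_log_convex[OF s] by simp
  then have 1: "(wallis (s + 1))\<^sup>2 * (s + 2) \<le> (wallis s)\<^sup>2 * (s + 1)"
    using s by (simp add: field_simps power2_eq_square)
  have "(pi / 2)\<^sup>2 \<le> ((s + 1) * wallis s * wallis (s + 1))\<^sup>2"
    using wallis_product_ge[OF s] by (intro power_mono) auto
  then have "(pi / 2)\<^sup>2 * (s + 2) \<le> (s + 1)\<^sup>2 * (wallis s)\<^sup>2 * ((wallis (s + 1))\<^sup>2 * (s + 2))"
    using s mult_right_mono[of _ _ "s + 2"] by (simp add: power_mult_distrib mult.assoc)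
  also have "\<dots> \<le> (s + 1)\<^sup>2 * (wallis s)\<^sup>2 * ((wallis s)\<^sup>2 * (s + 1))"
    using 1 by (intro mult_left_mono) auto
  also have "\<dots> = wallis s ^ 4 * (s + 1) ^ 3"
    by (simp add: power2_eq_square power4_eq_xxxx power3_eq_cube)
  finally show ?thesis using s
    by (simp add: pos_divide_le_eq power_divide)
qed

section \<open>Folding integrals of periodic functions\<close>

text \<open>Since 1/sin^2 = 1 + cot^2, this amounts to \<open>y * cos y \<le> sin y\<close>,
  squared.\<close>

lemma inverse_sin_squared_le:
  fixes y :: real
  assumes "0 < y" "y \<le> pi / 2"
  shows "1 / (sin y)\<^sup>2 \<le> 1 / y\<^sup>2 + 1"
proof -
  have s: "sin y > 0" using assms by (intro sin_gt_zero) auto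
  have "y * cos y \<le> sin y"
  proof -
    have "sin 0 - 0 * cos 0 \<le> sin y - y * cos y"
    proof (rule DERIV_nonneg_imp_nondecreasing[where f = "\<lambda>x. sin x - x * cos x"])
      fix x assume x: "0 \<le> x" "x \<le> y"
      have "((\<lambda>x. sin x - x * cos x) has_real_derivative x * sin x) (at x)"
        by (auto intro!: derivative_eq_intros)
      moreover have "0 \<le> x * sin x" using x assms by (intro mult_nonneg_nonneg sin_ge_zero) auto
      ultimately show "\<exists>d. ((\<lambda>x. sin x - x * cos x) has_real_derivative d) (at x) \<and> 0 \<le> d" by blast
    qed (use assms in simp)
    then show ?thesis by simp
  qed
  moreover have "0 \<le> y * cos y" using assms by (intro mult_nonneg_nonneg cos_ge_zero) auto
  ultimately have "(y * cos y)\<^sup>2 \<le> (sin y)\<^sup>2" by (intro power_mono)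
  then have "y\<^sup>2 * (1 - (sin y)\<^sup>2) \<le> (sin y)\<^sup>2"
    by (simp add: power_mult_distrib cos_squared_eq)
  then show ?thesis using s assms by (simp add: field_simps)
qed

lemma abs_cos_npi_minus: "\<bar>cos (real m * pi - x)\<bar> = \<bar>cos x\<bar>"
  by (simp add: cos_diff abs_mult)

lemma dyadic_pi_ge:
  assumes "e \<le> pi / 2"
  shows "e \<le> 2 ^ n * pi / 2"
proof -
  have "e \<le> 1 * (pi / 2)" using assms by simp
  also have "\<dots> \<le> 2 ^ n * (pi / 2)" by (intro mult_right_mono) auto
  finally show ?thesis by simp
qed

text \<open>The goal of this locale is a truncated lower bound for the identity that the integral of
  \<open>g x / x\<^sup>2\<close> over the positive axis equals \<open>s * wallis s\<close>.\<close>

locale abs_cos_power =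
  fixes s :: real
  assumes s: "s > 0"
begin

definition g :: "real \<Rightarrow> real" where "g x = 1 - \<bar>cos x\<bar> powr s"

lemma g_bounds: "0 \<le> g x" "g x \<le> 1"
  using powr_mono2[of s "\<bar>cos x\<bar>" 1] s by (auto simp: g_def abs_le_iff)

lemma continuous_on_g [continuous_intros]:
  fixes A :: "real set"
  shows "continuous_on A f \<Longrightarrow> continuous_on A (\<lambda>x. g (f x))"
  unfolding g_def using s by (intro continuous_on_diff continuous_on_powr' continuous_intros) auto

lemma g_npi_minus: "g (real m * pi - x) = g x"
  unfolding g_def abs_cos_npi_minus ..

text \<open>A finite substitute for the expansion of 1/sin^2 as the sum of 1/(x + k pi)^2: the
  kernel is \<open>g x / (sin x)\<^sup>2\<close> at \<open>n = 0\<close> and tends to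
  \<open>g x / x\<^sup>2\<close> as \<open>n\<close> grows.\<close>

definition fold_kernel :: "nat \<Rightarrow> real \<Rightarrow> real" where
  "fold_kernel n x = g x / (2 ^ n * sin (x / 2 ^ n))\<^sup>2"

lemma sin_dyadic_pos:
  assumes "0 < x" "x \<le> 2 ^ n * pi / 2"
  shows "sin (x / 2 ^ n) > 0"
proof (rule sin_gt_zero)
  have "x / 2 ^ n \<le> pi / 2" using assms by (simp add: field_simps)
  then show "x / 2 ^ n < pi" using pi_gt_zero by linarith
qed (use assms in simp)

lemma continuous_on_fold_kernel:
  assumes "0 < e"
  shows "continuous_on {e..2 ^ n * pi / 2} (fold_kernel n)"
  unfolding fold_kernel_def
proof (intro continuous_intros ballI)
  fix x assume "x \<in> {e..2 ^ n * pi / 2}"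
  then have "sin (x / 2 ^ n) > 0" using assms by (intro sin_dyadic_pos) auto
  then show "(2 ^ n * sin (x / 2 ^ n))\<^sup>2 \<noteq> 0" by simp
qed auto

text \<open>The reflection \<open>x \<mapsto> 2\<^sup>n \<pi> - x\<close> folds the outer half of the range of integration onto the
  inner one, and \<open>1/sin\<^sup>2 + 1/cos\<^sup>2 = 4/sin\<^sup>2(2 \<cdot>)\<close> then collapses the two kernels.\<close>

lemma fold_kernel_step:
  assumes e: "0 < e" "e \<le> pi / 2"
  shows "integral {e..2 ^ n * pi / 2} (fold_kernel n)
       \<le> integral {e..2 ^ Suc n * pi / 2} (fold_kernel (Suc n))"
proof -
  define L where "L = 2 ^ n * pi / 2"
  have L: "e \<le> L" unfolding L_def using e(2) by (rule dyadic_pi_ge)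
  define h where "h = fold_kernel (Suc n)"
  have cont: "continuous_on {e..2 * L} h"
    using continuous_on_fold_kernel[OF e(1), of "Suc n"] by (simp add: h_def L_def)
  have int: "h integrable_on {a..b}" if "e \<le> a" "b \<le> 2 * L" for a b
    by (rule integrable_continuous_interval, rule continuous_on_subset[OF cont]) (use that in auto)
  have hnn: "0 \<le> h x" for x using g_bounds by (simp add: h_def fold_kernel_def)
  have refl: "integral {e..L} (\<lambda>x. h (2 * L - x)) = integral {L..2 * L - e} h"
    using Henstock_Kurzweil_Integration.integral_reflect_real[of L e "\<lambda>x. h (2 * L - x)"]
          integral_shift_real_ivl[of L "2 * L" "2 * L - e" h]
    by (simp add: algebra_simps)
  have "integral {e..L} (fold_kernel n) = integral {e..L} (\<lambda>x. h x + h (2 * L - x))"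
  proof (rule integral_cong)
    fix x assume x: "x \<in> {e..L}"
    define y where "y = x / 2 ^ Suc n"
    have y: "0 < y" "y \<le> pi / 4"
      using x e by (auto simp: y_def L_def field_simps)
    have sc: "sin y > 0" "cos y > 0"
      using y pi_gt_zero by (auto intro!: sin_gt_zero cos_gt_zero simp del: pi_gt_zero)
    have "x / 2 ^ n = 2 * y" by (simp add: y_def)
    then have 1: "fold_kernel n x = g x / (2 ^ n * (2 * sin y * cos y))\<^sup>2"
      by (simp add: fold_kernel_def sin_double)
    have 2: "h x = g x / (2 ^ Suc n * sin y)\<^sup>2"
      by (simp add: h_def fold_kernel_def y_def)
    have "(2 * L - x) / 2 ^ Suc n = pi / 2 - y" by (simp add: L_def y_def field_simps)
    moreover have "g (2 * L - x) = g x" using g_npi_minus[of "2 ^ n" x] by (simp add: L_def)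
    ultimately have 3: "h (2 * L - x) = g x / (2 ^ Suc n * cos y)\<^sup>2"
      by (simp add: h_def fold_kernel_def sin_diff)
    have "h x + h (2 * L - x) = (g x * (cos y)\<^sup>2 + g x * (sin y)\<^sup>2) / ((2 ^ Suc n)\<^sup>2 * (sin y)\<^sup>2 * (cos y)\<^sup>2)"
      unfolding 2 3 using sc by (simp add: power_mult_distrib field_simps)
    also have "g x * (cos y)\<^sup>2 + g x * (sin y)\<^sup>2 = g x"
      by (simp flip: distrib_left)
    also have "g x / ((2 ^ Suc n)\<^sup>2 * (sin y)\<^sup>2 * (cos y)\<^sup>2) = fold_kernel n x"
      unfolding 1 by (simp add: power_mult_distrib mult_ac)
    finally show "fold_kernel n x = h x + h (2 * L - x)" ..
  qed
  also have "\<dots> = integral {e..L} h + integral {e..L} (\<lambda>x. h (2 * L - x))"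
  proof (rule integral_add)
    show "h integrable_on {e..L}" using int[of e L] L e by simp
    show "(\<lambda>x. h (2 * L - x)) integrable_on {e..L}"
      by (intro integrable_continuous_interval continuous_on_compose2[OF cont] continuous_intros)
         (use e L in auto)
  qed
  \<comment> \<open>The reflected part ends at \<open>2 * L - e\<close>. Extending it to
    \<open>2 * L\<close> adds a nonnegative amount, which is the only loss in the step.\<close>
  also have "\<dots> \<le> integral {e..L} h + integral {L..2 * L} h"
    unfolding refl using int[of L "2 * L"] int[of L "2 * L - e"] hnn L e
    by (intro add_left_mono integral_subset_le) auto
  also have "\<dots> = integral {e..2 * L} h"
    using L e int[of e "2 * L"] by (intro Henstock_Kurzweil_Integration.integral_combine) auto
  finally show ?thesis by (simp add: L_def h_def)
qed

lemma fold_kernel_le: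
  assumes e: "0 < e" "e \<le> pi / 2"
  shows "integral {e..pi / 2} (\<lambda>x. g x / (sin x)\<^sup>2) \<le> integral {e..2 ^ n * pi / 2} (fold_kernel n)"
proof (induction n)
  case 0 then show ?case by (simp add: fold_kernel_def)
next
  case (Suc n) then show ?case using fold_kernel_step[OF e, of n] by linarith
qed

text \<open>Integration by parts with antiderivative \<open>- cot x\<close> of 1/sin^2. The boundary
  term vanishes at \<open>pi / 2\<close> and has the favourable sign at \<open>e\<close>; the
  missing piece of \<open>wallis s\<close> over \<open>{0..e}\<close> is at most
  \<open>e\<close>.\<close>

lemma integral_g_sin:
  assumes e: "0 < e" "e \<le> pi / 2"
  shows "s * (wallis s - e) \<le> integral {e..pi / 2} (\<lambda>x. g x / (sin x)\<^sup>2)"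
proof -
  have sp: "sin x > 0" if "x \<in> {e..pi/2}" for x
    using that e pi_gt_zero by (intro sin_gt_zero) auto
  let ?F = "\<lambda>x. - (cos x / sin x) * (1 - cos x powr s)"
  have cont: "continuous_on {e..pi/2} (\<lambda>x. cos x powr s)"
    using continuous_on_cos_powr[OF s] by (rule continuous_on_subset) (use e in auto)
  have "((\<lambda>x. g x / (sin x)\<^sup>2 - s * cos x powr s) has_integral (?F (pi/2) - ?F e)) {e..pi/2}"
  proof (rule fundamental_theorem_of_calculus_interior[OF e(2)])
    show "continuous_on {e..pi/2} ?F"
      using sp by (intro continuous_intros cont) force
    fix x assume x: "x \<in> {e<..<pi/2}"
    have c: "cos x > 0" using x e by (intro cos_gt_zero) auto
    have sx: "sin x > 0" using sp[of x] x by simp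
    have "((\<lambda>x. - (cos x / sin x)) has_real_derivative
        - ((- sin x * sin x - cos x * cos x) / (sin x * sin x))) (at x)"
      using sx by (auto intro!: derivative_eq_intros)
    moreover have "- sin x * sin x - cos x * cos x = - 1"
      using sin_cos_squared_add3[of x] by linarith
    ultimately have "((\<lambda>x. - (cos x / sin x)) has_real_derivative 1 / (sin x)\<^sup>2) (at x)"
      by (simp add: power2_eq_square)
    moreover have "((\<lambda>x. 1 - cos x powr s) has_real_derivative s * cos x powr (s - 1) * sin x) (at x)"
      using c by (auto intro!: derivative_eq_intros)
    ultimately have "(?F has_real_derivative 1 / (sin x)\<^sup>2 * (1 - cos x powr s)
        + s * cos x powr (s - 1) * sin x * - (cos x / sin x)) (at x)"
      by (rule DERIV_mult)
    also have "1 / (sin x)\<^sup>2 * (1 - cos x powr s) + s * cos x powr (s - 1) * sin x * - (cos x / sin x)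
        = g x / (sin x)\<^sup>2 - s * cos x powr s"
      using c sx by (simp add: g_def powr_diff)
    finally show "(?F has_vector_derivative g x / (sin x)\<^sup>2 - s * cos x powr s) (at x)"
      by (simp add: has_real_derivative_iff_has_vector_derivative)
  qed
  then have "integral {e..pi/2} (\<lambda>x. g x / (sin x)\<^sup>2 - s * cos x powr s) = ?F (pi/2) - ?F e"
    by (rule integral_unique)
  moreover have "?F (pi/2) - ?F e \<ge> 0"
  proof -
    have "0 \<le> cos e" using e by (intro cos_ge_zero) auto
    moreover have "cos e powr s \<le> 1" using g_bounds(1)[of e] \<open>0 \<le> cos e\<close> by (simp add: g_def)
    ultimately show ?thesis using sp[of e] e by simp
  qed
  moreover have "integral {e..pi/2} (\<lambda>x. g x / (sin x)\<^sup>2 - s * cos x powr s)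
     = integral {e..pi/2} (\<lambda>x. g x / (sin x)\<^sup>2) - s * integral {e..pi/2} (\<lambda>x. cos x powr s)"
    using sp by (subst integral_diff)
      (force intro!: integrable_continuous_interval continuous_intros cont)+
  moreover have "wallis s - e \<le> integral {e..pi/2} (\<lambda>x. cos x powr s)"
  proof -
    have "wallis s = integral {0..e} (\<lambda>x. cos x powr s) + integral {e..pi/2} (\<lambda>x. cos x powr s)"
      unfolding wallis_def using e s
      by (intro Henstock_Kurzweil_Integration.integral_combine[symmetric] integrable_continuous_interval continuous_on_cos_powr) auto
    moreover have "integral {0..e} (\<lambda>x. cos x powr s) \<le> integral {0..e} (\<lambda>_. 1)"
    proof (rule integral_le)
      fix x assume "x \<in> {0..e}"
      then have "0 \<le> cos x" using e by (intro cos_ge_zero) auto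
      then show "cos x powr s \<le> 1" using g_bounds(1)[of x] by (simp add: g_def)
    qed (use e in \<open>auto intro!: integrable_continuous_interval continuous_on_subset[OF continuous_on_cos_powr[OF s]]\<close>)
    ultimately show ?thesis using e by simp
  qed
  ultimately show ?thesis using s
    by (smt (verit) mult_left_mono)
qed

text \<open>Replacing 1/sin^2 by 1/x^2 in the folded kernel costs at most \<open>1 / 4 ^ n\<close>
  pointwise, on an interval of length at most \<open>2 ^ n * pi / 2\<close>.\<close>

lemma integral_g_square:
  assumes e: "0 < e" "e \<le> pi / 2" and T: "2 ^ n * pi / 2 \<le> T"
  shows "s * (wallis s - e) - pi / 2 / 2 ^ n \<le> integral {e..T} (\<lambda>x. g x / x\<^sup>2)"
proof -
  define L where "L = 2 ^ n * pi / 2"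
  have eL: "e \<le> L" unfolding L_def using e(2) by (rule dyadic_pi_ge)
  have int: "(\<lambda>x. g x / x\<^sup>2) integrable_on {e..b}" for b
    using e by (intro integrable_continuous_interval continuous_intros) auto
  have "s * (wallis s - e) \<le> integral {e..L} (fold_kernel n)"
    using integral_g_sin[OF e] fold_kernel_le[OF e, of n] by (simp add: L_def)
  also have "\<dots> \<le> integral {e..L} (\<lambda>x. g x / x\<^sup>2 + 1 / 4 ^ n)"
  proof (rule integral_le)
    show "fold_kernel n integrable_on {e..L}"
      unfolding L_def by (rule integrable_continuous_interval, rule continuous_on_fold_kernel[OF e(1)])
    show "(\<lambda>x. g x / x\<^sup>2 + 1 / 4 ^ n) integrable_on {e..L}"
      using e by (intro integrable_continuous_interval continuous_intros) auto
    fix x assume x: "x \<in> {e..L}"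
    define y where "y = x / 2 ^ n"
    have y: "0 < y" "y \<le> pi / 2" "x = 2 ^ n * y" using x e by (auto simp: y_def L_def field_simps)
    have p4: "(4::real) ^ n = (2 ^ n)\<^sup>2" by (simp add: power2_eq_square flip: power_mult_distrib)
    have "fold_kernel n x = g x * (1 / (sin y)\<^sup>2) / 4 ^ n"
      by (simp add: fold_kernel_def y_def power_mult_distrib p4)
    also have "\<dots> \<le> g x * (1 / y\<^sup>2 + 1) / 4 ^ n"
      using inverse_sin_squared_le[OF y(1,2)] g_bounds
      by (intro divide_right_mono mult_left_mono) auto
    also have "\<dots> = g x / x\<^sup>2 + g x / 4 ^ n"
      using y by (simp add: p4 power_mult_distrib field_simps)
    also have "\<dots> \<le> g x / x\<^sup>2 + 1 / 4 ^ n"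
      using g_bounds by (intro add_left_mono divide_right_mono) auto
    finally show "fold_kernel n x \<le> g x / x\<^sup>2 + 1 / 4 ^ n" .
  qed
  also have "\<dots> = integral {e..L} (\<lambda>x. g x / x\<^sup>2) + (L - e) / 4 ^ n"
    using eL int by (subst integral_add) auto
  also have "integral {e..L} (\<lambda>x. g x / x\<^sup>2) \<le> integral {e..T} (\<lambda>x. g x / x\<^sup>2)"
    using T int g_bounds by (intro integral_subset_le) (auto simp: L_def)
  also have "(L - e) / 4 ^ n \<le> L / 4 ^ n" using e by (intro divide_right_mono) auto
  also have "L / 4 ^ n = pi / 2 / 2 ^ n"
    by (simp add: L_def field_simps flip: power_mult_distrib)
  finally show ?thesis by simp
qed

lemma integral_g_scaled:
  assumes a: "0 < a" and e: "0 < e"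
  shows "integral {e..T} (\<lambda>t. g (a * t) / t\<^sup>2) = a * integral {a * e..a * T} (\<lambda>x. g x / x\<^sup>2)"
proof -
  have img: "(\<lambda>x. x / a) ` {a * e..a * T} = {e..T}"
    using a by (auto simp: image_def field_simps intro!: bexI[of _ "a * _"])
  have "integral {e..T} (\<lambda>t. g (a * t) / (a * t)\<^sup>2) = 1 / a * integral {a * e..a * T} (\<lambda>x. g x / x\<^sup>2)"
    using integral_stretch_real[of a "a * e" "a * T" "\<lambda>x. g x / x\<^sup>2"] a unfolding img by simp
  moreover have "(\<lambda>t. g (a * t) / t\<^sup>2) = (\<lambda>t. a\<^sup>2 * (g (a * t) / (a * t)\<^sup>2))"
    using a by (auto simp: power_mult_distrib)
  then have "integral {e..T} (\<lambda>t. g (a * t) / t\<^sup>2) = a\<^sup>2 * integral {e..T} (\<lambda>t. g (a * t) / (a * t)\<^sup>2)"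
    by (simp only: integral_mult_right)
  ultimately have "integral {e..T} (\<lambda>t. g (a * t) / t\<^sup>2)
      = a\<^sup>2 * (1 / a * integral {a * e..a * T} (\<lambda>x. g x / x\<^sup>2))"
    by simp
  then show ?thesis using a by (simp add: power2_eq_square)
qed

text \<open>The folding depth \<open>n\<close> is fixed first, to make its error less than
  \<open>\<eta> / 2\<close>; then \<open>T\<close> is taken large enough that the lower cut-off
  costs less than \<open>\<eta> / 2\<close>.\<close>

lemma eventually_integral_ge:
  assumes a: "0 < a" and \<eta>: "0 < \<eta>"
  shows "eventually (\<lambda>T. a * s * wallis s - \<eta> \<le> integral {1 / T..T} (\<lambda>t. g (a * t) / t\<^sup>2)) at_top"
proof -
  have "(\<lambda>n. a * (pi / 2) / 2 ^ n) \<longlonglongrightarrow> 0" by real_asymp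
  then have "eventually (\<lambda>n. a * (pi / 2) / 2 ^ n < \<eta> / 2) sequentially"
    using \<eta> by (intro order_tendstoD) auto
  then obtain n where n: "a * (pi / 2) / 2 ^ n < \<eta> / 2"
    by (auto simp: eventually_sequentially)
  have "((\<lambda>T. a * (s * (a * (1 / T)))) \<longlongrightarrow> 0) at_top" using a s by real_asymp
  then have "eventually (\<lambda>T. a * (s * (a * (1 / T))) < \<eta> / 2) at_top"
    using \<eta> by (intro order_tendstoD) auto
  moreover have "((\<lambda>T. a * (1 / T)) \<longlongrightarrow> 0) at_top" using a by real_asymp
  then have "eventually (\<lambda>T. a * (1 / T) < pi / 2) at_top"
    by (intro order_tendstoD) auto
  moreover have "eventually (\<lambda>T. 2 ^ n * pi / 2 / a \<le> T) at_top" by (rule eventually_ge_at_top)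
  ultimately show ?thesis using eventually_gt_at_top[of 0]
  proof eventually_elim
    case (elim T)
    have "a * (s * (wallis s - a * (1 / T)) - pi / 2 / 2 ^ n)
        \<le> a * integral {a * (1 / T)..a * T} (\<lambda>x. g x / x\<^sup>2)"
      using elim a by (intro mult_left_mono integral_g_square) (auto simp: field_simps)
    also have "\<dots> = integral {1 / T..T} (\<lambda>t. g (a * t) / t\<^sup>2)"
      using integral_g_scaled[OF a, of "1 / T" T] elim by simp
    finally have "a * (s * (wallis s - a * (1 / T)) - pi / 2 / 2 ^ n) \<le> integral {1 / T..T} (\<lambda>t. g (a * t) / t\<^sup>2)" .
    moreover have "a * (s * (wallis s - a * (1 / T)) - pi / 2 / 2 ^ n)
        = a * s * wallis s - a * (s * (a * (1 / T))) - a * (pi / 2) / 2 ^ n"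
      by (simp add: algebra_simps)
    ultimately show ?case using n elim by linarith
  qed
qed

end

section \<open>Averages over signs\<close>

text \<open>The expectation of \<open>f\<close> at a Rademacher sum with coefficients
  \<open>b\<close>, written as a finite average so that no probability space is involved.\<close>

definition sign_avg :: "'i set \<Rightarrow> ('i \<Rightarrow> real) \<Rightarrow> (real \<Rightarrow> real) \<Rightarrow> real" where
  "sign_avg I b f = (\<Sum>e\<in>PiE I (\<lambda>_. {-1, 1}). f (\<Sum>j\<in>I. b j * e j)) / 2 ^ card I"

lemma sign_avg_empty [simp]: "sign_avg {} b f = f 0"
  by (simp add: sign_avg_def)

text \<open>Conditioning on one sign. The inductions below rest on this, with \<open>f\<close> or a
  shift left free because it changes at each step.\<close>

lemma sign_avg_insert:
  assumes "finite I" "i \<notin> I"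
  shows "sign_avg (insert i I) b f
    = (sign_avg I b (\<lambda>x. f (x + b i)) + sign_avg I b (\<lambda>x. f (x - b i))) / 2"
proof -
  let ?P = "PiE I (\<lambda>_. {-1, 1::real})"
  let ?S = "\<lambda>e. \<Sum>j\<in>I. b j * e j"
  have sum_upd: "(\<Sum>j\<in>insert i I. b j * (e(i := y)) j) = ?S e + b i * y" for e y
  proof -
    have "(\<Sum>j\<in>I. b j * (e(i := y)) j) = ?S e"
      using assms by (intro sum.cong) auto
    then show ?thesis using assms by simp
  qed
  have "(\<Sum>e\<in>PiE (insert i I) (\<lambda>_. {-1, 1}). f (\<Sum>j\<in>insert i I. b j * e j))
      = (\<Sum>(y, e)\<in>{-1, 1} \<times> ?P. f (\<Sum>j\<in>insert i I. b j * (e(i := y)) j))"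
    unfolding PiE_insert_eq using inj_combinator[OF assms(2), of "\<lambda>_. {-1, 1::real}"]
    by (subst sum.reindex) (auto simp: case_prod_unfold)
  also have "\<dots> = (\<Sum>e\<in>?P. f (?S e - b i)) + (\<Sum>e\<in>?P. f (?S e + b i))"
    unfolding sum_upd by (subst sum.cartesian_product[symmetric]) simp
  finally show ?thesis using assms by (simp add: sign_avg_def field_simps)
qed

lemma sign_avg_mono: "(\<And>x. f x \<le> g x) \<Longrightarrow> sign_avg I b f \<le> sign_avg I b g"
  by (simp add: sign_avg_def divide_right_mono sum_mono)

lemma sign_avg_add: "sign_avg I b (\<lambda>x. f x + g x) = sign_avg I b f + sign_avg I b g"
  by (simp add: sign_avg_def sum.distrib add_divide_distrib)

lemma sign_avg_diff: "sign_avg I b (\<lambda>x. f x - g x) = sign_avg I b f - sign_avg I b g"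
  by (simp add: sign_avg_def sum_subtractf diff_divide_distrib)

lemma sign_avg_cmult: "sign_avg I b (\<lambda>x. c * f x) = c * sign_avg I b f"
  by (simp add: sign_avg_def sum_distrib_left)

lemma sign_avg_divide: "sign_avg I b (\<lambda>x. f x / c) = sign_avg I b f / c"
  using sign_avg_cmult[of I b "1 / c" f] by simp

lemma sign_avg_const: "finite I \<Longrightarrow> sign_avg I b (\<lambda>_. c) = c"
  by (induction I rule: finite_induct) (simp_all add: sign_avg_insert)

lemma sign_avg_integral:
  assumes "\<And>x. f x integrable_on S"
  shows "sign_avg I b (\<lambda>x. integral S (f x)) = integral S (\<lambda>t. sign_avg I b (\<lambda>x. f x t))"
proof (cases "finite (PiE I (\<lambda>_. {-1, 1::real}))")
  case True
  then show ?thesis unfolding sign_avg_def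
    using assms by (simp add: integral_sum)
qed (simp add: sign_avg_def)

lemma sign_avg_abs_coeff:
  assumes "finite I"
  shows "sign_avg I (\<lambda>j. \<bar>b j\<bar>) f = sign_avg I b f"
  using assms
proof (induction I arbitrary: f rule: finite_induct)
  case (insert i I)
  then show ?case by (cases "b i \<ge> 0") (simp_all add: sign_avg_insert)
qed simp

section \<open>Cosine transform and moments of sign averages\<close>

text \<open>The addition formula for the cosine, with a phase \<open>c\<close> to make the induction
  close; \<open>c = 0\<close> gives the product formula for the characteristic function.\<close>

lemma sign_avg_cos:
  assumes "finite I"
  shows "sign_avg I b (\<lambda>x. cos (x * t + c)) = cos c * (\<Prod>j\<in>I. cos (b j * t))"
  using assms
proof (induction I arbitrary: c rule: finite_induct)
  case (insert i I)
  have "(x + b i) * t + c = x * t + (c + b i * t)" "(x - b i) * t + c = x * t + (c - b i * t)" for x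
    by (auto simp: algebra_simps)
  note * = this
  show ?case
    unfolding sign_avg_insert[OF insert.hyps] * insert.IH using insert.hyps
    by (simp add: cos_add cos_diff algebra_simps)
qed simp

lemma sign_avg_square:
  assumes "finite I"
  shows "sign_avg I b (\<lambda>x. (x + c)\<^sup>2) = c\<^sup>2 + (\<Sum>j\<in>I. (b j)\<^sup>2)"
  using assms
proof (induction I arbitrary: c rule: finite_induct)
  case (insert i I)
  have "x + b i + c = x + (c + b i)" "x - b i + c = x + (c - b i)" for x
    by auto
  note * = this
  show ?case
    unfolding sign_avg_insert[OF insert.hyps] * insert.IH using insert.hyps
    by (simp add: power2_sum power2_diff)
qed simp

text \<open>Each induction step drops the term \<open>2 * b i ^ 4\<close>, which leaves the Gaussian
  fourth moment as an upper bound.\<close>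

lemma sign_avg_fourth:
  assumes "finite I"
  shows "sign_avg I b (\<lambda>x. (x + c) ^ 4)
    \<le> c ^ 4 + 6 * c\<^sup>2 * (\<Sum>j\<in>I. (b j)\<^sup>2) + 3 * (\<Sum>j\<in>I. (b j)\<^sup>2)\<^sup>2"
  using assms
proof (induction I arbitrary: c rule: finite_induct)
  case (insert i I)
  let ?s = "\<Sum>j\<in>I. (b j)\<^sup>2"
  have *: "x + b i + c = x + (c + b i)" "x - b i + c = x + (c - b i)" for x
    by auto
  have "sign_avg (insert i I) b (\<lambda>x. (x + c) ^ 4)
      \<le> (((c + b i) ^ 4 + 6 * (c + b i)\<^sup>2 * ?s + 3 * ?s\<^sup>2)
        + ((c - b i) ^ 4 + 6 * (c - b i)\<^sup>2 * ?s + 3 * ?s\<^sup>2)) / 2"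
    using insert.IH[of "c + b i"] insert.IH[of "c - b i"] insert.hyps
    by (simp add: sign_avg_insert *)
  also have "\<dots> = c ^ 4 + 6 * c\<^sup>2 * ((b i)\<^sup>2 + ?s) + 3 * ((b i)\<^sup>2 + ?s)\<^sup>2 - 2 * b i ^ 4"
    by (simp add: power4_eq_xxxx power2_eq_square algebra_simps)
  also have "\<dots> \<le> c ^ 4 + 6 * c\<^sup>2 * ((b i)\<^sup>2 + ?s) + 3 * ((b i)\<^sup>2 + ?s)\<^sup>2"
    by simp
  finally show ?case unfolding sum.insert[OF insert.hyps] .
qed simp

text \<open>A minorant of the absolute value that combines second and fourth powers is averaged. The
  second moment contributes 3/4 and the fourth at most 3/16, and 3/4 - 3/16 = 9/16.\<close>

lemma sign_avg_abs_ge: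
  assumes I: "finite I"
  shows "9 / 16 * sqrt (\<Sum>j\<in>I. (b j)\<^sup>2) \<le> sign_avg I b abs"
proof -
  define \<sigma> where "\<sigma> = sqrt (\<Sum>j\<in>I. (b j)\<^sup>2)"
  have s2: "\<sigma>\<^sup>2 = (\<Sum>j\<in>I. (b j)\<^sup>2)" by (simp add: \<sigma>_def sum_nonneg)
  show ?thesis
  proof (cases "\<sigma> = 0")
    case True
    have "sign_avg I b (\<lambda>_. 0) \<le> sign_avg I b abs" by (rule sign_avg_mono) simp
    then show ?thesis using True I by (simp add: \<sigma>_def[symmetric] sign_avg_const)
  next
    case False
    then have \<sigma>: "\<sigma> > 0" by (simp add: \<sigma>_def sum_nonneg less_le)
    \<comment> \<open>The polynomial minorant is tangent to the absolute value at \<open>2\<sigma>\<close>.\<close>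
    have minor: "3 / (4 * \<sigma>) * (x + 0)\<^sup>2 - 1 / (16 * \<sigma> ^ 3) * (x + 0) ^ 4 \<le> \<bar>x\<bar>" for x
    proof -
      define u where "u = \<bar>x\<bar>"
      \<comment> \<open>The product expands to \<open>u ^ 4 - 12 * \<sigma>\<^sup>2 * u\<^sup>2 + 16
        * \<sigma> ^ 3 * u\<close>.\<close>
      have "0 \<le> u * ((u - 2 * \<sigma>)\<^sup>2 * (u + 4 * \<sigma>))"
        using \<sigma> by (simp add: u_def)
      then have "12 * \<sigma>\<^sup>2 * u\<^sup>2 - u ^ 4 \<le> 16 * \<sigma> ^ 3 * u"
        by (simp add: power2_eq_square power4_eq_xxxx power3_eq_cube algebra_simps)
      then have "(12 * \<sigma>\<^sup>2 * u\<^sup>2 - u ^ 4) / (16 * \<sigma> ^ 3) \<le> u"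
        using \<sigma> by (simp add: pos_divide_le_eq mult_ac)
      moreover have "(12 * \<sigma>\<^sup>2 * u\<^sup>2 - u ^ 4) / (16 * \<sigma> ^ 3) = 3 / (4 * \<sigma>) * u\<^sup>2 - 1 / (16 * \<sigma> ^ 3) * u ^ 4"
        using \<sigma> by (simp add: diff_divide_distrib power2_eq_square power3_eq_cube)
      moreover have "u\<^sup>2 = x\<^sup>2" "u ^ 4 = x ^ 4" by (simp_all add: u_def)
      ultimately show ?thesis by (simp add: u_def[symmetric])
    qed
    have "9 / 16 * \<sigma> = 3 / (4 * \<sigma>) * \<sigma>\<^sup>2 - 1 / (16 * \<sigma> ^ 3) * (3 * (\<sigma>\<^sup>2)\<^sup>2)"
      using \<sigma> by (simp add: field_simps power2_eq_square power3_eq_cube)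
    also have "\<dots> \<le> 3 / (4 * \<sigma>) * sign_avg I b (\<lambda>x. (x + 0)\<^sup>2) - 1 / (16 * \<sigma> ^ 3) * sign_avg I b (\<lambda>x. (x + 0) ^ 4)"
      using sign_avg_square[OF I, of b 0] sign_avg_fourth[OF I, of b 0] \<sigma>
      by (intro diff_mono mult_left_mono) (auto simp: s2)
    also have "\<dots> \<le> sign_avg I b abs"
      unfolding sign_avg_cmult[symmetric] sign_avg_diff[symmetric]
      by (intro sign_avg_mono minor)
    finally show ?thesis by (simp add: \<sigma>_def)
  qed
qed

text \<open>The variance of the absolute value of the sum is nonnegative.\<close>

lemma sign_avg_abs_le:
  assumes I: "finite I"
  shows "sign_avg I b abs \<le> sqrt (\<Sum>j\<in>I. (b j)\<^sup>2)"
proof -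
  define m where "m = sign_avg I b abs"
  have "0 \<le> sign_avg I b (\<lambda>x. (\<bar>x\<bar> - m)\<^sup>2)"
    using sign_avg_mono[of "\<lambda>_. 0" "\<lambda>x. (\<bar>x\<bar> - m)\<^sup>2" I b] I by (simp add: sign_avg_const)
  also have "\<dots> = sign_avg I b (\<lambda>x. (x + 0)\<^sup>2 + m\<^sup>2 - 2 * m * \<bar>x\<bar>)"
    by (simp add: power2_diff mult_ac)
  also have "\<dots> = (\<Sum>j\<in>I. (b j)\<^sup>2) - m\<^sup>2"
    using sign_avg_square[OF I, of b 0] I
    by (simp add: sign_avg_add sign_avg_diff sign_avg_cmult sign_avg_const m_def power2_eq_square)
  finally have "m\<^sup>2 \<le> (\<Sum>j\<in>I. (b j)\<^sup>2)" by simp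
  then show ?thesis unfolding m_def[symmetric] by (rule real_le_rsqrt)
qed

lemma sign_avg_perturb:
  assumes I: "finite I"
  shows "sign_avg I b abs \<le> sign_avg I d abs + sqrt (\<Sum>j\<in>I. (b j - d j)\<^sup>2)"
proof -
  have "sign_avg I b abs \<le> sign_avg I d abs + sign_avg I (\<lambda>j. b j - d j) abs"
    unfolding sign_avg_def add_divide_distrib[symmetric] sum.distrib[symmetric]
  proof (intro divide_right_mono sum_mono)
    fix e
    have "(\<Sum>j\<in>I. b j * e j) = (\<Sum>j\<in>I. d j * e j) + (\<Sum>j\<in>I. (b j - d j) * e j)"
      by (simp add: sum.distrib[symmetric] algebra_simps)
    then show "\<bar>\<Sum>j\<in>I. b j * e j\<bar> \<le> \<bar>\<Sum>j\<in>I. d j * e j\<bar> + \<bar>\<Sum>j\<in>I. (b j - d j) * e j\<bar>"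
      using abs_triangle_ineq by metis
  qed simp
  then show ?thesis using sign_avg_abs_le[OF I, of "\<lambda>j. b j - d j"] by linarith
qed

section \<open>Haagerup's lower bound\<close>

text \<open>Jensen's inequality for the exponential at the points \<open>ln (z j)\<close>, once a
  vanishing \<open>z j\<close> has been set aside.\<close>

lemma weighted_arith_geom_mean:
  fixes p z :: "'i \<Rightarrow> real"
  assumes I: "finite I" and p: "\<And>j. j \<in> I \<Longrightarrow> 0 \<le> p j" "(\<Sum>j\<in>I. p j) = 1"
    and z: "\<And>j. j \<in> I \<Longrightarrow> 0 \<le> z j"
  shows "(\<Prod>j\<in>I. z j powr p j) \<le> (\<Sum>j\<in>I. p j * z j)"
proof (cases "\<exists>j\<in>I. z j = 0")
  case True
  \<comment> \<open>Here \<open>0 powr p j\<close> is 0 even when \<open>p j = 0\<close>.\<close>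
  then have "(\<Prod>j\<in>I. z j powr p j) = 0" using I by (intro prod_zero) auto
  then show ?thesis using p z by (simp add: sum_nonneg)
next
  case False
  then have zp: "z j > 0" if "j \<in> I" for j using z[OF that] that by (auto simp: less_le)
  have "I \<noteq> {}" using p by auto
  have "(\<Prod>j\<in>I. z j powr p j) = exp (\<Sum>j\<in>I. p j *\<^sub>R ln (z j))"
    unfolding exp_sum[OF I] by (intro prod.cong) (auto simp: powr_def dest: zp)
  also have "\<dots> \<le> (\<Sum>j\<in>I. p j * exp (ln (z j)))"
    using convex_on_exp[of 1] by (intro convex_on_sum[OF I \<open>I \<noteq> {}\<close>, of UNIV exp]) (auto simp: p)
  also have "\<dots> = (\<Sum>j\<in>I. p j * z j)"
    using zp by (intro sum.cong) auto
  finally show ?thesis .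
qed

text \<open>The weighted inequality of the means with weights \<open>(a j)\<^sup>2\<close>: the
  exponent \<open>1 / (a j)\<^sup>2\<close> is chosen to cancel the weight in the geometric
  mean.\<close>

lemma prod_cos_le:
  fixes a :: "'i \<Rightarrow> real" and t :: real
  assumes I: "finite I" and a: "(\<Sum>j\<in>I. (a j)\<^sup>2) = 1"
  shows "(\<Prod>j\<in>I. cos (a j * t)) \<le> (\<Sum>j\<in>I. (a j)\<^sup>2 * \<bar>cos (\<bar>a j\<bar> * t)\<bar> powr (1 / (a j)\<^sup>2))"
proof -
  have "(\<Prod>j\<in>I. cos (a j * t)) \<le> \<bar>\<Prod>j\<in>I. cos (a j * t)\<bar>" by (rule abs_ge_self)
  also have "\<dots> = (\<Prod>j\<in>I. \<bar>cos (a j * t)\<bar>)" by (simp add: abs_prod)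
  also have "\<dots> = (\<Prod>j\<in>I. (\<bar>cos (\<bar>a j\<bar> * t)\<bar> powr (1 / (a j)\<^sup>2)) powr (a j)\<^sup>2)"
  proof (rule prod.cong)
    fix j
    have "cos (\<bar>a j\<bar> * t) = cos (a j * t)" by (simp add: abs_if)
    then show "\<bar>cos (a j * t)\<bar> = (\<bar>cos (\<bar>a j\<bar> * t)\<bar> powr (1 / (a j)\<^sup>2)) powr (a j)\<^sup>2"
      by (cases "a j = 0") (simp_all add: powr_powr)
  qed simp
  also have "\<dots> \<le> (\<Sum>j\<in>I. (a j)\<^sup>2 * \<bar>cos (\<bar>a j\<bar> * t)\<bar> powr (1 / (a j)\<^sup>2))"
    using a by (intro weighted_arith_geom_mean[OF I]) auto
  finally show ?thesis .
qed

text \<open>The cosine representation bounds the right side below by the integral of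
  \<open>(1 - (\<Prod>j\<in>I. cos (a j * t))) / t\<^sup>2\<close>. Separating the product leaves
  one integral of the locale \<open>abs_cos_power\<close> for each nonzero coefficient.\<close>

lemma sign_avg_abs_haagerup:
  assumes I: "finite I" and a: "(\<Sum>j\<in>I. (a j)\<^sup>2) = 1"
  shows "(\<Sum>j\<in>I. \<bar>a j\<bar> * wallis (1 / (a j)\<^sup>2)) \<le> pi / 2 * sign_avg I a abs"
proof (rule field_le_epsilon)
  fix \<eta> :: real assume \<eta>: "0 < \<eta>"
  define h where "h j t = (a j)\<^sup>2 * ((1 - \<bar>cos (\<bar>a j\<bar> * t)\<bar> powr (1 / (a j)\<^sup>2)) / t\<^sup>2)" for j t
  \<comment> \<open>The error is distributed as \<open>(a j)\<^sup>2 * \<eta>\<close>, so that the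
    errors add up to exactly \<open>\<eta>\<close>.\<close>
  have ev: "eventually (\<lambda>T. \<bar>a j\<bar> * wallis (1 / (a j)\<^sup>2) - (a j)\<^sup>2 * \<eta> \<le> integral {1 / T..T} (h j)) at_top" for j
  proof (cases "a j = 0")
    case False
    interpret abs_cos_power "1 / (a j)\<^sup>2" using False by unfold_locales simp
    have h: "h j = (\<lambda>t. (a j)\<^sup>2 * (g (\<bar>a j\<bar> * t) / t\<^sup>2))"
      by (auto simp: h_def g_def)
    have "eventually (\<lambda>T. \<bar>a j\<bar> * (1 / (a j)\<^sup>2) * wallis (1 / (a j)\<^sup>2) - \<eta>
        \<le> integral {1 / T..T} (\<lambda>t. g (\<bar>a j\<bar> * t) / t\<^sup>2)) at_top"
      using False \<eta> by (intro eventually_integral_ge) auto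
    then show ?thesis
    proof eventually_elim
      case (elim T)
      have "\<bar>a j\<bar> * wallis (1 / (a j)\<^sup>2) - (a j)\<^sup>2 * \<eta>
          = (a j)\<^sup>2 * (\<bar>a j\<bar> * (1 / (a j)\<^sup>2) * wallis (1 / (a j)\<^sup>2) - \<eta>)"
        using False by (simp add: field_simps)
      also have "\<dots> \<le> (a j)\<^sup>2 * integral {1 / T..T} (\<lambda>t. g (\<bar>a j\<bar> * t) / t\<^sup>2)"
        using elim by (intro mult_left_mono) auto
      finally show ?case unfolding h integral_mult_right .
    qed
  next
    case True
    then have "h j = (\<lambda>_. 0)" by (auto simp: h_def)
    then show ?thesis using True by simp
  qed
  have "eventually (\<lambda>T. \<forall>j\<in>I. \<bar>a j\<bar> * wallis (1 / (a j)\<^sup>2) - (a j)\<^sup>2 * \<eta> \<le> integral {1 / T..T} (h j)) at_top"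
    using ev I by (intro eventually_ball_finite) auto
  then have "eventually (\<lambda>T. (\<forall>j\<in>I. \<bar>a j\<bar> * wallis (1 / (a j)\<^sup>2) - (a j)\<^sup>2 * \<eta>
      \<le> integral {1 / T..T} (h j)) \<and> 1 \<le> T) at_top"
    by (intro eventually_conj eventually_ge_at_top)
  then obtain T where elim: "\<forall>j\<in>I. \<bar>a j\<bar> * wallis (1 / (a j)\<^sup>2) - (a j)\<^sup>2 * \<eta> \<le> integral {1 / T..T} (h j)" "1 \<le> T"
    using eventually_happens'[OF trivial_limit_at_top_linorder] by blast
  have T: "0 < 1 / T" "1 / T \<le> T" using elim(2) order_trans[of "1 / T" 1 T] by auto
  have cont: "continuous_on {1 / T..T} (\<lambda>t. (1 - cos (x * t)) / t\<^sup>2)" for x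
    using T by (intro continuous_intros) auto
  have hc: "h j integrable_on {1 / T..T}" for j
  proof (cases "a j = 0")
    case False
    interpret abs_cos_power "1 / (a j)\<^sup>2" using False by unfold_locales simp
    have "h j = (\<lambda>t. (a j)\<^sup>2 * (g (\<bar>a j\<bar> * t) / t\<^sup>2))"
      by (auto simp: h_def g_def)
    moreover have "continuous_on {1 / T..T} (\<lambda>t. (a j)\<^sup>2 * (g (\<bar>a j\<bar> * t) / t\<^sup>2))"
      using T by (intro continuous_intros) auto
    ultimately show ?thesis by (simp add: integrable_continuous_interval)
  next
    case True
    then have "h j = (\<lambda>_. 0)" by (auto simp: h_def)
    then show ?thesis by (simp add: integrable_0)
  qed
  have "(\<Sum>j\<in>I. \<bar>a j\<bar> * wallis (1 / (a j)\<^sup>2)) - \<eta>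
      = (\<Sum>j\<in>I. \<bar>a j\<bar> * wallis (1 / (a j)\<^sup>2) - (a j)\<^sup>2 * \<eta>)"
    by (simp add: sum_subtractf a flip: sum_distrib_right)
  also have "\<dots> \<le> (\<Sum>j\<in>I. integral {1 / T..T} (h j))"
    using elim by (intro sum_mono) auto
  also have "\<dots> = integral {1 / T..T} (\<lambda>t. \<Sum>j\<in>I. h j t)"
    using hc I by (intro integral_sum[symmetric])
  also have "\<dots> \<le> integral {1 / T..T} (\<lambda>t. sign_avg I a (\<lambda>x. (1 - cos (x * t)) / t\<^sup>2))"
  proof (rule integral_le)
    show "(\<lambda>t. \<Sum>j\<in>I. h j t) integrable_on {1 / T..T}"
      using hc I by (intro integrable_sum)
    show "(\<lambda>t. sign_avg I a (\<lambda>x. (1 - cos (x * t)) / t\<^sup>2)) integrable_on {1 / T..T}"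
      unfolding sign_avg_def by (intro integrable_continuous_interval continuous_intros cont) auto
    fix t assume "t \<in> {1 / T..T}"
    then have t: "t > 0" using less_le_trans[OF T(1), of t] by simp
    have "(\<Sum>j\<in>I. h j t) = (1 - (\<Sum>j\<in>I. (a j)\<^sup>2 * \<bar>cos (\<bar>a j\<bar> * t)\<bar> powr (1 / (a j)\<^sup>2))) / t\<^sup>2"
      by (simp add: h_def right_diff_distrib sum_subtractf a flip: sum_divide_distrib)
    also have "\<dots> \<le> (1 - (\<Prod>j\<in>I. cos (a j * t))) / t\<^sup>2"
      using prod_cos_le[OF I a, of t] by (intro divide_right_mono) auto
    also have "\<dots> = sign_avg I a (\<lambda>x. (1 - cos (x * t)) / t\<^sup>2)"
      using sign_avg_cos[OF I, of a t 0] I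
      by (simp add: sign_avg_divide sign_avg_diff sign_avg_const)
    finally show "(\<Sum>j\<in>I. h j t) \<le> sign_avg I a (\<lambda>x. (1 - cos (x * t)) / t\<^sup>2)" .
  qed
  also have "\<dots> = sign_avg I a (\<lambda>x. integral {1 / T..T} (\<lambda>t. (1 - cos (x * t)) / t\<^sup>2))"
    by (intro sign_avg_integral[symmetric] integrable_continuous_interval cont)
  also have "\<dots> \<le> sign_avg I a (\<lambda>x. pi / 2 * \<bar>x\<bar>)"
    by (intro sign_avg_mono integral_cos_le_abs T)
  also have "\<dots> = pi / 2 * sign_avg I a abs" by (rule sign_avg_cmult)
  finally show "(\<Sum>j\<in>I. \<bar>a j\<bar> * wallis (1 / (a j)\<^sup>2)) \<le> pi / 2 * sign_avg I a abs + \<eta>" by simp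
qed

text \<open>The bound on \<open>C\<close> is \<open>(2/\<pi> \<surd>s W(s))\<^sup>4 \<ge> 4/\<pi>\<^sup>2 (1 - v)(1 - v\<^sup>2)\<close> at \<open>v = 1/(s + 1)\<close>.\<close>

lemma coeff_wallis_ge:
  assumes a: "a\<^sup>2 \<le> v / (1 - v)" and v: "0 < v" "v < 1" and C: "0 \<le> C"
    and CC: "C ^ 4 * 3.1416\<^sup>2 \<le> 4 * ((1 - v) * (1 - v\<^sup>2))"
  shows "C * a\<^sup>2 * (pi / 2) \<le> \<bar>a\<bar> * wallis (1 / a\<^sup>2)"
proof (cases "a = 0")
  case False
  define s where "s = 1 / a\<^sup>2"
  define u where "u = 1 / (s + 1)"
  have s: "s > 0" using False by (simp add: s_def)
  have a2: "a\<^sup>2 = 1 / s" by (simp add: s_def)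
  have u: "0 < u" "u \<le> v"
  \<comment> \<open>The bound on \<open>a\<^sup>2\<close> says \<open>s \<ge> (1 - v) / v\<close>,
    that is, \<open>u \<le> v\<close>.\<close>
  proof -
    have "(1 - v) \<le> s * v" using a s v unfolding a2 by (simp add: field_simps)
    then show "0 < u" "u \<le> v" using s v by (auto simp: u_def field_simps)
  qed
  have "(1 - v) * (1 - v\<^sup>2) \<le> (1 - u) * (1 - u\<^sup>2)"
    using u v by (intro mult_mono diff_mono power_mono) (auto simp: power_le_one)
  also have "\<dots> = s\<^sup>2 * (s + 2) / (s + 1) ^ 3"
  proof -
    have "1 - u\<^sup>2 = ((s + 1)\<^sup>2 - 1) / (s + 1)\<^sup>2"
      using s by (simp add: u_def power_divide diff_divide_distrib)
    also have "(s + 1)\<^sup>2 - 1 = s * (s + 2)"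
      by (simp add: power2_eq_square algebra_simps)
    finally have "1 - u\<^sup>2 = s * (s + 2) / (s + 1)\<^sup>2" .
    moreover have "1 - u = s / (s + 1)" using s by (simp add: u_def field_simps)
    ultimately show ?thesis by (simp add: power2_eq_square power3_eq_cube mult_ac)
  qed
  finally have *: "4 * ((1 - v) * (1 - v\<^sup>2)) \<le> 4 * (s\<^sup>2 * (s + 2) / (s + 1) ^ 3)" by simp
  \<comment> \<open>The rational upper bound for \<open>pi\<close> makes the hypothesis
    \<open>CC\<close> a numerical check.\<close>
  have pi2: "pi\<^sup>2 \<le> 3.1416\<^sup>2" using pi_approx(2) by (intro power_mono) auto
  have "(C * (pi / 2)) ^ 4 = C ^ 4 * pi\<^sup>2 * (pi\<^sup>2 / 16)"
    by (simp add: power_mult_distrib power2_eq_square power4_eq_xxxx)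
  also have "\<dots> \<le> C ^ 4 * 3.1416\<^sup>2 * (pi\<^sup>2 / 16)"
    using pi2 C by (intro mult_right_mono mult_left_mono) auto
  also have "\<dots> \<le> 4 * (s\<^sup>2 * (s + 2) / (s + 1) ^ 3) * (pi\<^sup>2 / 16)"
    using CC * by (intro mult_right_mono) auto
  also have "\<dots> = s\<^sup>2 * (pi\<^sup>2 / 4 * (s + 2) / (s + 1) ^ 3)" by simp
  also have "\<dots> \<le> s\<^sup>2 * wallis s ^ 4"
    using wallis_lower[OF s] by (intro mult_left_mono) auto
  also have "\<dots> = (sqrt s * wallis s) ^ 4"
    using s by (simp add: power_mult_distrib power4_eq_xxxx power2_eq_square)
  finally have "C * (pi / 2) \<le> sqrt s * wallis s"
    using s wallis_nonneg[of s] by (simp add: power_mono_iff C)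
  then have "C * (pi / 2) * a\<^sup>2 \<le> sqrt s * wallis s * a\<^sup>2"
    by (rule mult_right_mono) simp
  also have "\<dots> = (sqrt s * a\<^sup>2) * wallis s" by simp
  also have "sqrt s * a\<^sup>2 = \<bar>a\<bar>"
    using False by (cases "a > 0") (simp_all add: s_def real_sqrt_divide power2_eq_square)
  finally show ?thesis by (simp add: s_def mult_ac)
qed simp

text \<open>Choosing \<open>v / (1 - v)\<close> equal to 1/2 and to 9/25 gives
  \<open>v = 1 / 3\<close> and \<open>v = 9 / 34\<close>, with constants 0.6995 and 0.725. The
  smaller one carries weight at most 1/2, so the average is at least 0.71225.\<close>

lemma sign_avg_abs_far:
  assumes I: "finite I" and a: "(\<Sum>j\<in>I. (a j)\<^sup>2) = 1"
    and i: "i \<in> I" "(a i)\<^sup>2 \<le> 1 / 2"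
    and rest: "\<And>j. j \<in> I \<Longrightarrow> j \<noteq> i \<Longrightarrow> \<bar>a j\<bar> \<le> 3 / 5"
  shows "0.712 \<le> sign_avg I a abs"
proof -
  have "0.6995 * (a i)\<^sup>2 * (pi / 2) \<le> \<bar>a i\<bar> * wallis (1 / (a i)\<^sup>2)"
    by (rule coeff_wallis_ge[where v = "1 / 3"]) (use i in \<open>simp_all add: power2_eq_square power4_eq_xxxx\<close>)
  moreover have "0.725 * (a j)\<^sup>2 * (pi / 2) \<le> \<bar>a j\<bar> * wallis (1 / (a j)\<^sup>2)" if j: "j \<in> I - {i}" for j
  proof -
    have "\<bar>a j\<bar>\<^sup>2 \<le> (3 / 5)\<^sup>2" using rest[of j] j by (intro power_mono) auto
    then show ?thesis
      by (intro coeff_wallis_ge[where v = "9 / 34"]) (simp_all add: power2_eq_square power4_eq_xxxx)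
  qed
  then have "(\<Sum>j\<in>I - {i}. 0.725 * (a j)\<^sup>2 * (pi / 2)) \<le> (\<Sum>j\<in>I - {i}. \<bar>a j\<bar> * wallis (1 / (a j)\<^sup>2))"
    by (intro sum_mono)
  moreover have "(\<Sum>j\<in>I. \<bar>a j\<bar> * wallis (1 / (a j)\<^sup>2)) = \<bar>a i\<bar> * wallis (1 / (a i)\<^sup>2)
      + (\<Sum>j\<in>I - {i}. \<bar>a j\<bar> * wallis (1 / (a j)\<^sup>2))"
    using I i by (intro sum.remove)
  moreover have "(\<Sum>j\<in>I - {i}. (a j)\<^sup>2) = 1 - (a i)\<^sup>2"
    using sum.remove[OF I i(1), of "\<lambda>j. (a j)\<^sup>2"] a by simp
  then have "(\<Sum>j\<in>I - {i}. 0.725 * (a j)\<^sup>2 * (pi / 2)) = 0.725 * (1 - (a i)\<^sup>2) * (pi / 2)"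
    by (simp only: flip: sum_distrib_right sum_distrib_left)
  ultimately have "0.6995 * (a i)\<^sup>2 * (pi / 2) + 0.725 * (1 - (a i)\<^sup>2) * (pi / 2) \<le> pi / 2 * sign_avg I a abs"
    using sign_avg_abs_haagerup[OF I a] by linarith
  then have "pi / 2 * (0.6995 * (a i)\<^sup>2 + 0.725 * (1 - (a i)\<^sup>2)) \<le> pi / 2 * sign_avg I a abs"
    by (simp add: algebra_simps)
  then have "0.6995 * (a i)\<^sup>2 + 0.725 * (1 - (a i)\<^sup>2) \<le> sign_avg I a abs"
    by (simp add: mult_le_cancel_left_pos)
  then show ?thesis using i by (simp add: field_simps)
qed

section \<open>Symmetric i.i.d. sequences close to signs\<close>

text \<open>Conditional Jensen for the convex map that sends \<open>z\<close> to
  \<open>max c z\<close>. Concretely, \<open>Z\<close> may be replaced by its mean on the event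
  \<open>C < \<beta>\<close>, since it is independent of that event.\<close>

lemma (in prob_space) expectation_max_indep:
  fixes C Z :: "'a \<Rightarrow> real"
  assumes indep: "indep_var borel C borel Z"
    and C: "integrable M C" and Z: "integrable M Z" and \<beta>: "\<beta> \<le> expectation Z"
  shows "expectation (\<lambda>\<omega>. max (C \<omega>) \<beta>) \<le> expectation (\<lambda>\<omega>. max (C \<omega>) (Z \<omega>))"
proof -
  have [measurable]: "C \<in> borel_measurable M" "Z \<in> borel_measurable M" using C Z by auto
  define I where "I \<omega> = (indicator {..<\<beta>} (C \<omega>) :: real)" for \<omega>
  have [measurable]: "I \<in> borel_measurable M" unfolding I_def by measurable
  have int_I: "integrable M I"
    by (rule integrable_const_bound[where B = 1]) (auto simp: I_def indicator_def)
  have "indep_var borel ((indicator {..<\<beta>} :: real \<Rightarrow> real) \<circ> C) borel (id \<circ> Z)"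
    by (rule indep_var_compose[OF indep]) auto
  then have IZ: "indep_var borel I borel Z"
    by (simp add: I_def[abs_def] comp_def)
  note prod = indep_var_lebesgue_integral[OF IZ int_I Z] indep_var_integrable[OF IZ int_I Z]
  have CI: "integrable M (\<lambda>\<omega>. C \<omega> - C \<omega> * I \<omega>)"
    by (rule Bochner_Integration.integrable_bound[OF C]) (auto simp: I_def indicator_def)
  have "expectation (\<lambda>\<omega>. max (C \<omega>) \<beta>) = expectation (\<lambda>\<omega>. (C \<omega> - C \<omega> * I \<omega>) + \<beta> * I \<omega>)"
    by (intro Bochner_Integration.integral_cong) (auto simp: I_def indicator_def)
  also have "\<dots> = expectation (\<lambda>\<omega>. C \<omega> - C \<omega> * I \<omega>) + \<beta> * expectation I"
    using CI int_I by simp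
  also have "\<dots> \<le> expectation (\<lambda>\<omega>. C \<omega> - C \<omega> * I \<omega>) + expectation I * expectation Z"
    using mult_left_mono[OF \<beta>, of "expectation I"] Bochner_Integration.integral_nonneg[of M I]
    by (simp add: I_def mult.commute)
  also have "\<dots> = expectation (\<lambda>\<omega>. (C \<omega> - C \<omega> * I \<omega>) + I \<omega> * Z \<omega>)"
    using CI prod by simp
  also have "\<dots> \<le> expectation (\<lambda>\<omega>. max (C \<omega>) (Z \<omega>))"
    using CI prod C Z by (intro integral_mono) (auto simp: I_def indicator_def)
  finally show ?thesis .
qed

text \<open>Factor \<open>r\<^sup>2 - x\<^sup>2\<close> and \<open>r\<^sup>2 - y\<^sup>2\<close>:
  both sums \<open>r + x\<close> and \<open>r + y\<close> are at least 0.7 + 0.6.\<close>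

lemma pair_deficit:
  fixes x y r :: real
  assumes r: "r\<^sup>2 = 1 / 2" "0.7 \<le> r" and x: "3 / 5 \<le> x" "x \<le> r" and y: "3 / 5 \<le> y" "y \<le> r"
  shows "1.3 * (2 * r - x - y) \<le> 1 - x\<^sup>2 - y\<^sup>2"
proof -
  have "1.3 * (r - x) \<le> (r + x) * (r - x)" "1.3 * (r - y) \<le> (r + y) * (r - y)"
    by (rule mult_right_mono; use r x y in simp)+
  moreover have "(r + x) * (r - x) = r\<^sup>2 - x\<^sup>2" "(r + y) * (r - y) = r\<^sup>2 - y\<^sup>2"
    by (simp_all add: power2_eq_square algebra_simps)
  ultimately show ?thesis using r by simp
qed

text \<open>\<open>A + max 0 (B - A)\<close> is \<open>max A B\<close>, and lowering
  \<open>A\<close> to \<open>C\<close> costs at most \<open>L\<close>.\<close>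

lemma max_tent_le:
  fixes A B C L :: real
  assumes "A \<le> C + L" "0 \<le> L"
  shows "A + max 0 (B - A) - L \<le> max C B"
  using assms by (auto simp: max_def)

locale near_sign_sequence = prob_space M for M :: "'a measure" +
  fixes X :: "nat \<Rightarrow> 'a \<Rightarrow> real" and \<delta> :: real
  assumes indep: "indep_vars (\<lambda>_. borel) X {1..}"
    and ident: "\<And>j. 1 \<le> j \<Longrightarrow> distr M borel (X j) = distr M borel (X 1)"
    and sym: "distr M borel (\<lambda>\<omega>. - X 1 \<omega>) = distr M borel (X 1)"
    and \<delta>: "0 < \<delta>"
    and close_int: "integrable M (\<lambda>\<omega>. (\<bar>X 1 \<omega>\<bar> - 1)\<^sup>2)"
    and close: "expectation (\<lambda>\<omega>. (\<bar>X 1 \<omega>\<bar> - 1)\<^sup>2) \<le> \<delta>\<^sup>2"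
begin

lemma rv: "1 \<le> j \<Longrightarrow> X j \<in> borel_measurable M"
  using indep by (auto simp: indep_vars_def)

lemma expectation_ident:
  fixes f :: "real \<Rightarrow> real"
  assumes j: "1 \<le> j" and f: "f \<in> borel_measurable borel"
  shows "expectation (\<lambda>\<omega>. f (X j \<omega>)) = expectation (\<lambda>\<omega>. f (X 1 \<omega>))"
    and "integrable M (\<lambda>\<omega>. f (X j \<omega>)) \<longleftrightarrow> integrable M (\<lambda>\<omega>. f (X 1 \<omega>))"
  using integral_distr[OF rv[OF j] f] integral_distr[OF rv[of 1] f]
    integrable_distr_eq[OF rv[OF j] f] integrable_distr_eq[OF rv[of 1] f] ident[OF j]
  by auto

lemma sym_ident:
  assumes j: "1 \<le> j"
  shows "distr M borel (\<lambda>\<omega>. - X j \<omega>) = distr M borel (X j)"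
proof -
  have neg: "distr M borel (\<lambda>\<omega>. - X j \<omega>) = distr (distr M borel (X j)) borel uminus" if "1 \<le> j" for j
    using rv[OF that] by (subst distr_distr) (auto simp: comp_def)
  show ?thesis using neg[OF j] neg[of 1] ident[OF j] sym by simp
qed

lemma close_int': "1 \<le> j \<Longrightarrow> integrable M (\<lambda>\<omega>. (\<bar>X j \<omega>\<bar> - 1)\<^sup>2)"
  using expectation_ident(2)[of j "\<lambda>x. (\<bar>x\<bar> - 1)\<^sup>2"] close_int by simp

lemma close': "1 \<le> j \<Longrightarrow> expectation (\<lambda>\<omega>. (\<bar>X j \<omega>\<bar> - 1)\<^sup>2) \<le> \<delta>\<^sup>2"
  using expectation_ident(1)[of j "\<lambda>x. (\<bar>x\<bar> - 1)\<^sup>2"] close by simp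

lemma integrable_X:
  assumes j: "1 \<le> j"
  shows "integrable M (X j)"
proof (rule Bochner_Integration.integrable_bound)
  show "integrable M (\<lambda>\<omega>. 2 + (\<bar>X j \<omega>\<bar> - 1)\<^sup>2)" using close_int'[OF j] by simp
  have "\<bar>x\<bar> \<le> 2 + (\<bar>x\<bar> - 1)\<^sup>2" for x :: real
    using zero_le_power2[of "\<bar>x\<bar> - 3 / 2"] by (simp add: power2_eq_square algebra_simps)
  then show "AE \<omega> in M. norm (X j \<omega>) \<le> norm (2 + (\<bar>X j \<omega>\<bar> - 1)\<^sup>2)"
    by simp
qed (rule rv[OF j])

lemma expectation_dev:
  assumes j: "1 \<le> j"
  shows "expectation (\<lambda>\<omega>. \<bar>\<bar>X j \<omega>\<bar> - 1\<bar>) \<le> \<delta>"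
proof -
  \<comment> \<open>The arithmetic-geometric mean at scale \<open>\<delta>\<close> takes the place
    of Cauchy-Schwarz.\<close>
  have *: "\<bar>x\<bar> \<le> (x\<^sup>2 / \<delta> + \<delta>) / 2" for x
  proof -
    have "2 * \<delta> * \<bar>x\<bar> \<le> x\<^sup>2 + \<delta>\<^sup>2" using zero_le_power2[of "\<bar>x\<bar> - \<delta>"] by (simp add: power2_diff mult_ac)
    then show ?thesis using \<delta> by (simp add: field_simps power2_eq_square)
  qed
  have "expectation (\<lambda>\<omega>. \<bar>\<bar>X j \<omega>\<bar> - 1\<bar>) \<le> expectation (\<lambda>\<omega>. ((\<bar>X j \<omega>\<bar> - 1)\<^sup>2 / \<delta> + \<delta>) / 2)"
    using integrable_X[OF j] close_int'[OF j] by (intro integral_mono *) auto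
  also have "\<dots> = (expectation (\<lambda>\<omega>. (\<bar>X j \<omega>\<bar> - 1)\<^sup>2) / \<delta> + \<delta>) / 2"
    using close_int'[OF j] by (simp add: prob_space)
  also have "\<dots> \<le> (\<delta>\<^sup>2 / \<delta> + \<delta>) / 2"
    using close'[OF j] \<delta> by (intro divide_right_mono add_right_mono) auto
  finally show ?thesis using \<delta> by (simp add: power2_eq_square)
qed

definition mean_abs :: real where "mean_abs = expectation (\<lambda>\<omega>. \<bar>X 1 \<omega>\<bar>)"

lemma mean_abs: "1 \<le> j \<Longrightarrow> expectation (\<lambda>\<omega>. \<bar>X j \<omega>\<bar>) = mean_abs"
  unfolding mean_abs_def by (rule expectation_ident) auto

lemma mean_abs_bounds: "0 \<le> mean_abs" "mean_abs \<le> 1 + \<delta>"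
proof -
  show "0 \<le> mean_abs" by (simp add: mean_abs_def)
  have "mean_abs \<le> expectation (\<lambda>\<omega>. 1 + \<bar>\<bar>X 1 \<omega>\<bar> - 1\<bar>)"
    unfolding mean_abs_def using integrable_X[of 1] by (intro integral_mono) auto
  also have "\<dots> = 1 + expectation (\<lambda>\<omega>. \<bar>\<bar>X 1 \<omega>\<bar> - 1\<bar>)"
    using integrable_X[of 1] by (simp add: prob_space)
  finally show "mean_abs \<le> 1 + \<delta>" using expectation_dev[of 1] by simp
qed

section \<open>Symmetrization and comparison with Rademacher sums\<close>

text \<open>Flipping signs preserves each marginal law and independence, hence the joint law on the
  product space.\<close>

lemma expectation_flip:
  assumes I: "finite I" "I \<subseteq> {1..}" and e: "\<And>j. j \<in> I \<Longrightarrow> e j \<in> {-1, 1}"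
  shows "expectation (\<lambda>\<omega>. \<bar>\<Sum>j\<in>I. a j * (e j * X j \<omega>)\<bar>) = expectation (\<lambda>\<omega>. \<bar>\<Sum>j\<in>I. a j * X j \<omega>\<bar>)"
proof (cases "I = {}")
  case False
  let ?P = "PiM I (\<lambda>_. borel) :: (nat \<Rightarrow> real) measure"
  have ind: "indep_vars (\<lambda>_. borel) X I" using indep_vars_subset[OF indep I(2)] .
  have ind': "indep_vars (\<lambda>_. borel) (\<lambda>j \<omega>. e j * X j \<omega>) I"
    by (rule indep_vars_compose2[OF ind, of "\<lambda>j x. e j * x"]) auto
  have rvI [measurable]: "X j \<in> borel_measurable M" if "j \<in> I" for j
    using I that by (intro rv) auto
  have "distr M borel (\<lambda>\<omega>. e j * X j \<omega>) = distr M borel (X j)" if j: "j \<in> I" for j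
    using e[OF j] sym_ident[of j] I j by auto
  then have "distr M ?P (\<lambda>\<omega>. \<lambda>j\<in>I. e j * X j \<omega>) = distr M ?P (\<lambda>\<omega>. \<lambda>j\<in>I. X j \<omega>)"
    using indep_vars_iff_distr_eq_PiM'[OF False, where M' = "\<lambda>_. borel" and X = X] ind
      indep_vars_iff_distr_eq_PiM'[OF False, where M' = "\<lambda>_. borel" and X = "\<lambda>j \<omega>. e j * X j \<omega>"] ind' rvI
    by (simp cong: PiM_cong)
  then have "integral\<^sup>L (distr M ?P (\<lambda>\<omega>. \<lambda>j\<in>I. e j * X j \<omega>)) (\<lambda>x. \<bar>\<Sum>j\<in>I. a j * x j\<bar>)
      = integral\<^sup>L (distr M ?P (\<lambda>\<omega>. \<lambda>j\<in>I. X j \<omega>)) (\<lambda>x. \<bar>\<Sum>j\<in>I. a j * x j\<bar>)"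
    by simp
  then show ?thesis
    by (subst (asm) (1 2) integral_distr) (simp_all cong: sum.cong)
qed simp

text \<open>By symmetry the expectation is that of a sign average with random coefficients. For each
  outcome, replacing every \<open>\<bar>X j \<omega>\<bar>\<close> by 1 costs at most the square
  root of \<open>?z \<omega>\<close>, whose mean is at most
  \<open>\<delta> * \<sigma>\<close>.\<close>

lemma expectation_abs_ge_sign_avg:
  assumes I: "finite I" "I \<subseteq> {1..}"
  shows "sign_avg I a abs - \<delta> * sqrt (\<Sum>j\<in>I. (a j)\<^sup>2) \<le> expectation (\<lambda>\<omega>. \<bar>\<Sum>j\<in>I. a j * X j \<omega>\<bar>)"
proof -
  define \<sigma> where "\<sigma> = sqrt (\<Sum>j\<in>I. (a j)\<^sup>2)"
  have s2: "(\<Sum>j\<in>I. (a j)\<^sup>2) = \<sigma>\<^sup>2" by (simp add: \<sigma>_def sum_nonneg)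
  have int: "integrable M (X j)" "1 \<le> j" if "j \<in> I" for j using that I by (auto intro!: integrable_X)
  show ?thesis
  proof (cases "\<sigma> = 0")
    case True
    have "0 \<le> expectation (\<lambda>\<omega>. \<bar>\<Sum>j\<in>I. a j * X j \<omega>\<bar>)" by simp
    moreover have "sign_avg I a abs \<le> \<sigma>" unfolding \<sigma>_def by (rule sign_avg_abs_le[OF I(1)])
    moreover have "\<delta> * \<sigma> = 0" using True by simp
    ultimately show ?thesis unfolding \<sigma>_def[symmetric] True by linarith
  next
    case False
    then have \<sigma>: "\<sigma> > 0" by (simp add: \<sigma>_def sum_nonneg less_le)
    let ?A = "\<lambda>\<omega>. sign_avg I (\<lambda>j. a j * X j \<omega>) abs"
    let ?z = "\<lambda>\<omega>. \<Sum>j\<in>I. (a j)\<^sup>2 * (\<bar>X j \<omega>\<bar> - 1)\<^sup>2"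
    let ?P = "PiE I (\<lambda>_. {-1, 1::real})"
    have intS: "integrable M (\<lambda>\<omega>. \<bar>\<Sum>j\<in>I. a j * (e j * X j \<omega>)\<bar>)" for e
      using int by (intro integrable_abs Bochner_Integration.integrable_sum) auto
    have A: "?A = (\<lambda>\<omega>. (\<Sum>e\<in>?P. \<bar>\<Sum>j\<in>I. a j * (e j * X j \<omega>)\<bar>) / 2 ^ card I)"
      by (simp add: sign_avg_def mult_ac)
    have intA: "integrable M ?A" unfolding A using intS by auto
    have EA: "expectation ?A = expectation (\<lambda>\<omega>. \<bar>\<Sum>j\<in>I. a j * X j \<omega>\<bar>)"
    proof -
      have "expectation ?A = (\<Sum>e\<in>?P. expectation (\<lambda>\<omega>. \<bar>\<Sum>j\<in>I. a j * (e j * X j \<omega>)\<bar>)) / 2 ^ card I"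
        unfolding A using intS by (simp add: Bochner_Integration.integral_sum)
      also have "\<dots> = (\<Sum>e\<in>?P. expectation (\<lambda>\<omega>. \<bar>\<Sum>j\<in>I. a j * X j \<omega>\<bar>)) / 2 ^ card I"
        by (intro arg_cong2[where f = "(/)"] sum.cong expectation_flip I refl) (auto dest: PiE_mem)
      finally show ?thesis using I by (simp add: card_PiE)
    qed
    have intz: "integrable M ?z" using close_int' int by (intro Bochner_Integration.integrable_sum) auto
    have "expectation ?z = (\<Sum>j\<in>I. (a j)\<^sup>2 * expectation (\<lambda>\<omega>. (\<bar>X j \<omega>\<bar> - 1)\<^sup>2))"
      using close_int' int by (subst Bochner_Integration.integral_sum) auto
    also have "\<dots> \<le> (\<Sum>j\<in>I. (a j)\<^sup>2 * \<delta>\<^sup>2)"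
      using close' int by (intro sum_mono mult_left_mono) auto
    also have "\<dots> = \<sigma>\<^sup>2 * \<delta>\<^sup>2" by (simp add: s2 flip: sum_distrib_right)
    finally have Ez: "expectation ?z \<le> \<sigma>\<^sup>2 * \<delta>\<^sup>2" .
    have point: "sign_avg I a abs \<le> ?A \<omega> + (?z \<omega> / (\<delta> * \<sigma>) + \<delta> * \<sigma>) / 2" for \<omega>
    proof -
      have 1: "?A \<omega> = sign_avg I (\<lambda>j. a j * \<bar>X j \<omega>\<bar>) abs"
        using sign_avg_abs_coeff[OF I(1), of "\<lambda>j. a j * X j \<omega>" abs]
              sign_avg_abs_coeff[OF I(1), of "\<lambda>j. a j * \<bar>X j \<omega>\<bar>" abs]
        by (simp add: abs_mult)
      define r where "r = sqrt (?z \<omega>)"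
      have r: "r\<^sup>2 = ?z \<omega>" by (simp add: r_def sum_nonneg)
      have "(\<Sum>j\<in>I. (a j - a j * \<bar>X j \<omega>\<bar>)\<^sup>2) = ?z \<omega>"
        by (intro sum.cong) (auto simp: power2_eq_square algebra_simps)
      then have "sign_avg I a abs \<le> ?A \<omega> + r"
        using sign_avg_perturb[OF I(1), of a "\<lambda>j. a j * \<bar>X j \<omega>\<bar>"] by (simp add: 1 r_def)
      \<comment> \<open>Linearises the square root so that only the mean of \<open>?z\<close>
        enters; the scale \<open>\<delta> * \<sigma>\<close> balances the two terms.\<close>
      moreover have "r \<le> (r\<^sup>2 / (\<delta> * \<sigma>) + \<delta> * \<sigma>) / 2"
      proof -
        have "2 * (\<delta> * \<sigma>) * r \<le> r\<^sup>2 + (\<delta> * \<sigma>)\<^sup>2"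
          using zero_le_power2[of "r - \<delta> * \<sigma>"] by (simp add: power2_diff algebra_simps)
        then have "2 * r \<le> (r\<^sup>2 + (\<delta> * \<sigma>)\<^sup>2) / (\<delta> * \<sigma>)"
          using \<sigma> \<delta> by (simp add: pos_le_divide_eq mult_ac)
        then show ?thesis using \<sigma> \<delta> by (simp add: add_divide_distrib power2_eq_square)
      qed
      ultimately show ?thesis unfolding r by linarith
    qed
    have "sign_avg I a abs = expectation (\<lambda>_. sign_avg I a abs)" by (simp add: prob_space)
    also have "\<dots> \<le> expectation (\<lambda>\<omega>. ?A \<omega> + (?z \<omega> / (\<delta> * \<sigma>) + \<delta> * \<sigma>) / 2)"
      using intA intz by (intro integral_mono point) auto
    also have "\<dots> = expectation ?A + (expectation ?z / (\<delta> * \<sigma>) + \<delta> * \<sigma>) / 2"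
      using intA intz by (simp add: prob_space)
    also have "\<dots> \<le> expectation ?A + (\<sigma>\<^sup>2 * \<delta>\<^sup>2 / (\<delta> * \<sigma>) + \<delta> * \<sigma>) / 2"
      using Ez \<sigma> \<delta> by (intro add_left_mono divide_right_mono add_right_mono) auto
    also have "\<dots> = expectation ?A + \<delta> * \<sigma>"
      using \<sigma> \<delta> by (simp add: power2_eq_square)
    finally show ?thesis by (simp add: EA \<sigma>_def)
  qed
qed

section \<open>Two independent copies\<close>

lemma indep_pair:
  assumes "1 \<le> i" "1 \<le> k" "i \<noteq> k"
  shows "indep_var borel (X i) borel (X k)"
proof -
  have "indep_var borel ((\<lambda>x. x i) \<circ> (\<lambda>\<omega>. restrict (\<lambda>j. X j \<omega>) {i})) borel ((\<lambda>x. x k) \<circ> (\<lambda>\<omega>. restrict (\<lambda>j. X j \<omega>) {k}))"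
    using assms by (intro indep_var_compose[OF indep_var_restrict[OF indep]]) auto
  then show ?thesis by (simp add: comp_def)
qed

definition mean_gap :: real where
  "mean_gap = expectation (\<lambda>\<omega>. \<bar>\<bar>X 1 \<omega>\<bar> - \<bar>X 2 \<omega>\<bar>\<bar>)"

text \<open>Every pair of distinct indices has the same joint law, the square of the law of
  \<open>X 1\<close>.\<close>

lemma mean_gap:
  assumes ik: "1 \<le> i" "1 \<le> k" "i \<noteq> k"
  shows "expectation (\<lambda>\<omega>. \<bar>\<bar>X i \<omega>\<bar> - \<bar>X k \<omega>\<bar>\<bar>) = mean_gap"
proof -
  let ?\<mu> = "distr M borel (X 1)"
  have *: "expectation (\<lambda>\<omega>. \<bar>\<bar>X i \<omega>\<bar> - \<bar>X k \<omega>\<bar>\<bar>)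
      = integral\<^sup>L (?\<mu> \<Otimes>\<^sub>M ?\<mu>) (\<lambda>(x, y). \<bar>\<bar>x\<bar> - \<bar>y\<bar>\<bar>)"
    if ik: "1 \<le> i" "1 \<le> k" "i \<noteq> k" for i k
  proof -
    have "?\<mu> \<Otimes>\<^sub>M ?\<mu> = distr M (borel \<Otimes>\<^sub>M borel) (\<lambda>\<omega>. (X i \<omega>, X k \<omega>))"
      using indep_pair[OF ik] ident[OF ik(1)] ident[OF ik(2)]
      by (simp add: indep_var_distribution_eq)
    then show ?thesis
      using rv[OF ik(1)] rv[OF ik(2)] by (simp add: integral_distr)
  qed
  show ?thesis unfolding mean_gap_def using *[OF ik] *[of 1 2] by simp
qed

lemma mean_gap_bounds: "0 \<le> mean_gap" "mean_gap \<le> 2 * \<delta>"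
proof -
  show "0 \<le> mean_gap" by (simp add: mean_gap_def)
  have "mean_gap \<le> expectation (\<lambda>\<omega>. \<bar>\<bar>X 1 \<omega>\<bar> - 1\<bar> + \<bar>\<bar>X 2 \<omega>\<bar> - 1\<bar>)"
    unfolding mean_gap_def using integrable_X[of 1] integrable_X[of 2] by (intro integral_mono) auto
  also have "\<dots> = expectation (\<lambda>\<omega>. \<bar>\<bar>X 1 \<omega>\<bar> - 1\<bar>) + expectation (\<lambda>\<omega>. \<bar>\<bar>X 2 \<omega>\<bar> - 1\<bar>)"
    using integrable_X[of 1] integrable_X[of 2] by simp
  finally show "mean_gap \<le> 2 * \<delta>" using expectation_dev[of 1] expectation_dev[of 2] by simp
qed

text \<open>\<open>X 1 + X 2\<close> and \<open>X 1 - X 2\<close> have equal absolute means, and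
  pointwise the two absolute values add up to \<open>\<bar>u\<bar> + \<bar>v\<bar> +
  \<bar>\<bar>u\<bar> - \<bar>v\<bar>\<bar>\<close>.\<close>

lemma expectation_pair: "expectation (\<lambda>\<omega>. \<bar>X 1 \<omega> + X 2 \<omega>\<bar>) = mean_abs + mean_gap / 2"
proof -
  have int: "integrable M (X 1)" "integrable M (X 2)" by (auto intro: integrable_X)
  have "expectation (\<lambda>\<omega>. \<bar>X 1 \<omega> - X 2 \<omega>\<bar>) = expectation (\<lambda>\<omega>. \<bar>X 1 \<omega> + X 2 \<omega>\<bar>)"
    using expectation_flip[of "{1, 2}" "\<lambda>j. if j = 2 then -1 else 1" "\<lambda>_. 1"] by simp
  moreover have "expectation (\<lambda>\<omega>. \<bar>X 1 \<omega> + X 2 \<omega>\<bar>) + expectation (\<lambda>\<omega>. \<bar>X 1 \<omega> - X 2 \<omega>\<bar>)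
      = expectation (\<lambda>\<omega>. \<bar>X 1 \<omega> + X 2 \<omega>\<bar> + \<bar>X 1 \<omega> - X 2 \<omega>\<bar>)"
    using int by simp
  moreover have "\<dots> = expectation (\<lambda>\<omega>. \<bar>X 1 \<omega>\<bar> + \<bar>X 2 \<omega>\<bar> + \<bar>\<bar>X 1 \<omega>\<bar> - \<bar>X 2 \<omega>\<bar>\<bar>)"
    by (intro Bochner_Integration.integral_cong) (auto simp: abs_if)
  moreover have "\<dots> = 2 * mean_abs + mean_gap"
    using int mean_abs[of 1] mean_abs[of 2] by (simp add: mean_gap_def)
  ultimately show ?thesis by simp
qed

text \<open>Pigeonhole: most of the mass of \<open>\<bar>X\<bar>\<close> lies in at most \<open>4\<delta>/w + 2\<close> cells of length \<open>w\<close>, so two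
  independent copies fall into the same cell with probability at least \<open>(3/4)\<^sup>2/(4\<delta>/w + 2)\<close>.\<close>

lemma expectation_gap_tent:
  assumes ik: "1 \<le> i" "1 \<le> k" "i \<noteq> k" and w: "0 < w" and r: "0 \<le> r" "r \<le> 1"
  shows "w\<^sup>2 * (9 / 16) / (4 * \<delta> + 2 * w)
    \<le> expectation (\<lambda>\<omega>. max 0 (2 * w - r * \<bar>\<bar>X i \<omega>\<bar> - \<bar>X k \<omega>\<bar>\<bar>))"
proof -
  define Z where "Z = {\<lfloor>(1 - 2 * \<delta>) / w\<rfloor>..\<lfloor>(1 + 2 * \<delta>) / w\<rfloor>}"
  define c where "c z x = (if \<lfloor>\<bar>x\<bar> / w\<rfloor> = z then 1 else 0 :: real)" for z and x :: real
  define p where "p z = expectation (\<lambda>\<omega>. c z (X 1 \<omega>))" for z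
  have c_meas [measurable]: "c z \<in> borel_measurable borel" for z unfolding c_def by measurable
  have c_int: "integrable M (\<lambda>\<omega>. c z (X j \<omega>))" if "1 \<le> j" for z j
    by (rule integrable_const_bound[where B = 1]) (use rv[OF that] in \<open>auto simp: c_def\<close>)
  have p: "expectation (\<lambda>\<omega>. c z (X j \<omega>)) = p z" if "1 \<le> j" for z j
    unfolding p_def using that by (intro expectation_ident) auto
  have sum_c: "(\<Sum>z\<in>Z. c z x) = (if \<lfloor>\<bar>x\<bar> / w\<rfloor> \<in> Z then 1 else 0)" for x
    by (simp add: c_def Z_def)
  \<comment> \<open>Chebyshev's inequality at distance \<open>2 * \<delta>\<close>: the cells in
    \<open>Z\<close> cover that neighbourhood of 1.\<close>
  have "3 / 4 \<le> (\<Sum>z\<in>Z. p z)"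
  proof -
    have "1 - (\<bar>x\<bar> - 1)\<^sup>2 / (4 * \<delta>\<^sup>2) \<le> (\<Sum>z\<in>Z. c z x)" for x
    proof (cases "\<bar>\<bar>x\<bar> - 1\<bar> \<le> 2 * \<delta>")
      case True
      then have "\<lfloor>\<bar>x\<bar> / w\<rfloor> \<in> Z"
        using w by (auto simp: Z_def intro!: floor_mono divide_right_mono)
      then show ?thesis by (simp add: sum_c)
    next
      case False
      then have "(2 * \<delta>)\<^sup>2 \<le> \<bar>\<bar>x\<bar> - 1\<bar>\<^sup>2" using \<delta> by (intro power_mono) auto
      then have "1 - (\<bar>x\<bar> - 1)\<^sup>2 / (4 * \<delta>\<^sup>2) \<le> 0" using \<delta> by (simp add: power_mult_distrib)
      then show ?thesis by (simp add: sum_c)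
    qed
    then have "expectation (\<lambda>\<omega>. 1 - (\<bar>X 1 \<omega>\<bar> - 1)\<^sup>2 / (4 * \<delta>\<^sup>2)) \<le> expectation (\<lambda>\<omega>. \<Sum>z\<in>Z. c z (X 1 \<omega>))"
      using close_int c_int by (intro integral_mono) auto
    also have "\<dots> = (\<Sum>z\<in>Z. p z)"
      using c_int by (simp add: p_def Bochner_Integration.integral_sum)
    finally have "1 - expectation (\<lambda>\<omega>. (\<bar>X 1 \<omega>\<bar> - 1)\<^sup>2) / (4 * \<delta>\<^sup>2) \<le> (\<Sum>z\<in>Z. p z)"
      using close_int by (simp add: prob_space)
    moreover have "expectation (\<lambda>\<omega>. (\<bar>X 1 \<omega>\<bar> - 1)\<^sup>2) / (4 * \<delta>\<^sup>2) \<le> \<delta>\<^sup>2 / (4 * \<delta>\<^sup>2)"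
      using close by (intro divide_right_mono) auto
    moreover have "\<delta>\<^sup>2 / (4 * \<delta>\<^sup>2) = 1 / 4" using \<delta> by simp
    ultimately show ?thesis by linarith
  qed
  then have "(3 / 4)\<^sup>2 \<le> (\<Sum>z\<in>Z. p z)\<^sup>2" by (intro power_mono) auto
  \<comment> \<open>Cauchy-Schwarz over the cells; the sum of squares is the probability that both
    copies lie in the same cell of \<open>Z\<close>.\<close>
  also have "\<dots> \<le> (\<Sum>z\<in>Z. (p z)\<^sup>2) * real (card Z)" by (rule sum_squared_le_sum_of_squares)
  also have "\<dots> \<le> (\<Sum>z\<in>Z. (p z)\<^sup>2) * (4 * \<delta> / w + 2)"
  proof (intro mult_left_mono sum_nonneg)
    have "(1 + 2 * \<delta>) / w = ((1 - 2 * \<delta>) + 4 * \<delta>) / w" by simp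
    also have "\<dots> = (1 - 2 * \<delta>) / w + 4 * \<delta> / w" by (rule add_divide_distrib)
    finally have "(1 + 2 * \<delta>) / w = (1 - 2 * \<delta>) / w + 4 * \<delta> / w" .
    moreover have "0 < 4 * \<delta> / w" using \<delta> w by simp
    ultimately show "real (card Z) \<le> 4 * \<delta> / w + 2" unfolding Z_def card_atLeastAtMost_int by linarith
  qed simp
  finally have "9 / 16 \<le> (\<Sum>z\<in>Z. (p z)\<^sup>2) * (4 * \<delta> + 2 * w) / w"
    using w by (simp add: field_simps power2_eq_square)
  then have "w * (9 / 16) \<le> (\<Sum>z\<in>Z. (p z)\<^sup>2) * (4 * \<delta> + 2 * w)"
    using w by (subst (asm) pos_le_divide_eq) (simp_all only: mult.commute)
  then have "w * (w * (9 / 16)) \<le> w * ((\<Sum>z\<in>Z. (p z)\<^sup>2) * (4 * \<delta> + 2 * w))"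
    using w by (intro mult_left_mono) auto
  then have "w\<^sup>2 * (9 / 16) / (4 * \<delta> + 2 * w) \<le> w * (\<Sum>z\<in>Z. (p z)\<^sup>2)"
    using w \<delta> by (subst pos_divide_le_eq) (auto simp: power2_eq_square mult.assoc)
  also have "\<dots> = expectation (\<lambda>\<omega>. w * (\<Sum>z\<in>Z. c z (X i \<omega>) * c z (X k \<omega>)))"
  proof -
    have ind: "indep_var borel (\<lambda>\<omega>. c z (X i \<omega>)) borel (\<lambda>\<omega>. c z (X k \<omega>))" for z
      using indep_var_compose[OF indep_pair[OF ik] c_meas[of z] c_meas[of z]] by (simp add: comp_def)
    show ?thesis
      using indep_var_integrable[OF ind c_int c_int] indep_var_lebesgue_integral[OF ind c_int c_int] ik p
      by (simp add: Bochner_Integration.integral_sum power2_eq_square)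
  qed
  \<comment> \<open>Two values in one cell differ by at most \<open>w\<close>, where the tent of
    height \<open>2 * w\<close> is still at least \<open>w\<close>.\<close>
  also have "\<dots> \<le> expectation (\<lambda>\<omega>. max 0 (2 * w - r * \<bar>\<bar>X i \<omega>\<bar> - \<bar>X k \<omega>\<bar>\<bar>))"
  proof (rule integral_mono)
    have ind: "indep_var borel (\<lambda>\<omega>. c z (X i \<omega>)) borel (\<lambda>\<omega>. c z (X k \<omega>))" for z
      using indep_var_compose[OF indep_pair[OF ik] c_meas[of z] c_meas[of z]] by (simp add: comp_def)
    show "integrable M (\<lambda>\<omega>. w * (\<Sum>z\<in>Z. c z (X i \<omega>) * c z (X k \<omega>)))"
      using indep_var_integrable[OF ind c_int c_int] ik by simp
    show "integrable M (\<lambda>\<omega>. max 0 (2 * w - r * \<bar>\<bar>X i \<omega>\<bar> - \<bar>X k \<omega>\<bar>\<bar>))"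
      using integrable_X[OF ik(1)] integrable_X[OF ik(2)] by simp
    fix \<omega>
    show "w * (\<Sum>z\<in>Z. c z (X i \<omega>) * c z (X k \<omega>)) \<le> max 0 (2 * w - r * \<bar>\<bar>X i \<omega>\<bar> - \<bar>X k \<omega>\<bar>\<bar>)"
    proof (cases "\<lfloor>\<bar>X i \<omega>\<bar> / w\<rfloor> = \<lfloor>\<bar>X k \<omega>\<bar> / w\<rfloor>")
      case True
      then have "\<bar>\<bar>X i \<omega>\<bar> / w - \<bar>X k \<omega>\<bar> / w\<bar> \<le> 1" by linarith
      then have "\<bar>\<bar>X i \<omega>\<bar> - \<bar>X k \<omega>\<bar>\<bar> \<le> w"
        using w by (simp add: field_simps flip: diff_divide_distrib)
      then have "r * \<bar>\<bar>X i \<omega>\<bar> - \<bar>X k \<omega>\<bar>\<bar> \<le> 1 * w" using r by (intro mult_mono) auto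
      moreover have "(\<Sum>z\<in>Z. c z (X i \<omega>) * c z (X k \<omega>)) = (\<Sum>z\<in>Z. c z (X i \<omega>))"
        using True by (intro sum.cong) (auto simp: c_def)
      then have "(\<Sum>z\<in>Z. c z (X i \<omega>) * c z (X k \<omega>)) \<le> 1" by (simp add: sum_c)
      then have "w * (\<Sum>z\<in>Z. c z (X i \<omega>) * c z (X k \<omega>)) \<le> w * 1"
        using w by (intro mult_left_mono) auto
      ultimately show ?thesis by linarith
    next
      case False
      then have "(\<Sum>z\<in>Z. c z (X i \<omega>) * c z (X k \<omega>)) = 0"
        by (intro sum.neutral) (auto simp: c_def)
      then show ?thesis by simp
    qed
  qed
  finally show ?thesis .
qed

section \<open>Two large coefficients\<close>

text \<open>Averaging over the signs of the three parts uses \<open>\<bar>p + y\<bar> + \<bar>p -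
  y\<bar> = 2 * max \<bar>p\<bar> \<bar>y\<bar>\<close> for \<open>p = u + v\<close> and
  \<open>p = u - v\<close>. The larger of the two \<open>\<bar>p\<bar>\<close> is
  \<open>\<bar>u\<bar> + \<bar>v\<bar>\<close>, where \<open>y\<close> is discarded; the smaller is
  \<open>\<bar>\<bar>u\<bar> - \<bar>v\<bar>\<bar>\<close>, where \<open>y\<close> is kept.\<close>

lemma expectation_abs_split:
  assumes I: "finite I" "I \<subseteq> {1..}" and ik: "i \<in> I" "k \<in> I" "i \<noteq> k"
    and \<beta>: "\<beta> \<le> expectation (\<lambda>\<omega>. \<bar>\<Sum>j\<in>I - {i, k}. a j * X j \<omega>\<bar>)"
  shows "((\<bar>a i\<bar> + \<bar>a k\<bar>) * mean_abs + expectation (\<lambda>\<omega>. max \<bar>\<bar>a i\<bar> * \<bar>X i \<omega>\<bar> - \<bar>a k\<bar> * \<bar>X k \<omega>\<bar>\<bar> \<beta>)) / 2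
    \<le> expectation (\<lambda>\<omega>. \<bar>\<Sum>j\<in>I. a j * X j \<omega>\<bar>)"
proof -
  define J where "J = I - {i, k}"
  define U where "U \<omega> = a i * X i \<omega>" for \<omega>
  define V where "V \<omega> = a k * X k \<omega>" for \<omega>
  define Y where "Y \<omega> = (\<Sum>j\<in>J. a j * X j \<omega>)" for \<omega>
  define C where "C \<omega> = \<bar>\<bar>a i\<bar> * \<bar>X i \<omega>\<bar> - \<bar>a k\<bar> * \<bar>X k \<omega>\<bar>\<bar>" for \<omega>
  have ge1: "1 \<le> j" if "j \<in> I" for j using I that by auto
  have J: "finite J" "J \<subseteq> I" "i \<notin> J" "k \<notin> J" "I = insert i (insert k J)"
    using I ik by (auto simp: J_def)
  have intX: "integrable M (X j)" if "j \<in> I" for j using ge1[OF that] by (rule integrable_X)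
  have int: "integrable M U" "integrable M V" "integrable M Y" "integrable M C"
    using intX ik J(2) unfolding U_def V_def Y_def C_def
    by (auto intro!: Bochner_Integration.integrable_sum)
  have flip: "expectation (\<lambda>\<omega>. \<bar>su * U \<omega> + sv * V \<omega> + sy * Y \<omega>\<bar>) = expectation (\<lambda>\<omega>. \<bar>\<Sum>j\<in>I. a j * X j \<omega>\<bar>)"
    if "su \<in> {-1, 1}" "sv \<in> {-1, 1}" "sy \<in> {-1, 1}" for su sv sy
  proof -
    define e where "e j = (if j = i then su else if j = k then sv else sy)" for j
    have "(\<Sum>j\<in>I. a j * (e j * X j \<omega>)) = su * U \<omega> + sv * V \<omega> + sy * Y \<omega>" for \<omega>
    proof -
      have "(\<Sum>j\<in>J. a j * (e j * X j \<omega>)) = (\<Sum>j\<in>J. sy * (a j * X j \<omega>))"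
        using J by (intro sum.cong) (auto simp: e_def)
      then show ?thesis using J ik
        by (simp add: e_def U_def V_def Y_def mult_ac flip: sum_distrib_left)
    qed
    moreover have "e j \<in> {-1, 1}" for j using that by (auto simp: e_def)
    ultimately show ?thesis using expectation_flip[OF I, of e a] by simp
  qed
  \<comment> \<open>Four of the eight sign patterns are enough, as a global sign does not change the
    absolute value.\<close>
  have "expectation (\<lambda>\<omega>. 2 * (\<bar>U \<omega>\<bar> + \<bar>V \<omega>\<bar>) + 2 * max (C \<omega>) \<bar>Y \<omega>\<bar>)
      \<le> expectation (\<lambda>\<omega>. \<bar>1 * U \<omega> + 1 * V \<omega> + 1 * Y \<omega>\<bar> + \<bar>1 * U \<omega> + 1 * V \<omega> + -1 * Y \<omega>\<bar>
        + \<bar>1 * U \<omega> + -1 * V \<omega> + 1 * Y \<omega>\<bar> + \<bar>1 * U \<omega> + -1 * V \<omega> + -1 * Y \<omega>\<bar>)"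
  proof (rule integral_mono)
    fix \<omega>
    have *: "2 * (\<bar>u\<bar> + \<bar>v\<bar>) + 2 * max \<bar>\<bar>u\<bar> - \<bar>v\<bar>\<bar> \<bar>y\<bar> \<le> \<bar>u + v + y\<bar> + \<bar>u + v - y\<bar> + \<bar>u - v + y\<bar> + \<bar>u - v - y\<bar>"
      for u v y :: real
    proof -
      have "\<bar>p + y\<bar> + \<bar>p - y\<bar> = 2 * max \<bar>p\<bar> \<bar>y\<bar>" for p :: real
        by (simp add: max_def abs_if)
      from this[of "u + v"] this[of "u - v"]
      have "\<bar>u + v + y\<bar> + \<bar>u + v - y\<bar> + \<bar>u - v + y\<bar> + \<bar>u - v - y\<bar>
          = 2 * max \<bar>u + v\<bar> \<bar>y\<bar> + 2 * max \<bar>u - v\<bar> \<bar>y\<bar>" by linarith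
      note eq = this
      have m: "2 * (\<bar>u\<bar> + \<bar>v\<bar>) \<le> 2 * max (\<bar>u\<bar> + \<bar>v\<bar>) \<bar>y\<bar>"
        by (intro mult_left_mono max.cobounded1) simp
      have "\<bar>u + v\<bar> = \<bar>u\<bar> + \<bar>v\<bar> \<and> \<bar>u - v\<bar> = \<bar>\<bar>u\<bar> - \<bar>v\<bar>\<bar>
          \<or> \<bar>u - v\<bar> = \<bar>u\<bar> + \<bar>v\<bar> \<and> \<bar>u + v\<bar> = \<bar>\<bar>u\<bar> - \<bar>v\<bar>\<bar>"
        by linarith
      then show ?thesis
      proof (elim disjE conjE)
        assume e: "\<bar>u + v\<bar> = \<bar>u\<bar> + \<bar>v\<bar>" "\<bar>u - v\<bar> = \<bar>\<bar>u\<bar> - \<bar>v\<bar>\<bar>"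
        show ?thesis unfolding eq e by (rule add_right_mono[OF m])
      next
        assume e: "\<bar>u - v\<bar> = \<bar>u\<bar> + \<bar>v\<bar>" "\<bar>u + v\<bar> = \<bar>\<bar>u\<bar> - \<bar>v\<bar>\<bar>"
        show ?thesis unfolding eq e by (subst add.commute) (rule add_left_mono[OF m])
      qed
    qed
    have "C \<omega> = \<bar>\<bar>U \<omega>\<bar> - \<bar>V \<omega>\<bar>\<bar>" by (simp add: C_def U_def V_def abs_mult)
    then show "2 * (\<bar>U \<omega>\<bar> + \<bar>V \<omega>\<bar>) + 2 * max (C \<omega>) \<bar>Y \<omega>\<bar>
        \<le> \<bar>1 * U \<omega> + 1 * V \<omega> + 1 * Y \<omega>\<bar> + \<bar>1 * U \<omega> + 1 * V \<omega> + -1 * Y \<omega>\<bar>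
        + \<bar>1 * U \<omega> + -1 * V \<omega> + 1 * Y \<omega>\<bar> + \<bar>1 * U \<omega> + -1 * V \<omega> + -1 * Y \<omega>\<bar>"
      using *[of "U \<omega>" "V \<omega>" "Y \<omega>"] by simp
  qed (use int in auto)
  also have "\<dots> = 4 * expectation (\<lambda>\<omega>. \<bar>\<Sum>j\<in>I. a j * X j \<omega>\<bar>)"
    using flip[of 1 1 1] flip[of 1 1 "-1"] flip[of 1 "-1" 1] flip[of 1 "-1" "-1"] int by simp
  finally have 1: "2 * (expectation (\<lambda>\<omega>. \<bar>U \<omega>\<bar>) + expectation (\<lambda>\<omega>. \<bar>V \<omega>\<bar>)) + 2 * expectation (\<lambda>\<omega>. max (C \<omega>) \<bar>Y \<omega>\<bar>)
      \<le> 4 * expectation (\<lambda>\<omega>. \<bar>\<Sum>j\<in>I. a j * X j \<omega>\<bar>)"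
    using int by simp
  have 2: "expectation (\<lambda>\<omega>. \<bar>U \<omega>\<bar>) = \<bar>a i\<bar> * mean_abs" "expectation (\<lambda>\<omega>. \<bar>V \<omega>\<bar>) = \<bar>a k\<bar> * mean_abs"
    using mean_abs[OF ge1] ik by (simp_all add: U_def V_def abs_mult)
  have ind: "indep_var borel C borel (\<lambda>\<omega>. \<bar>Y \<omega>\<bar>)"
  proof -
    have "indep_var
        borel ((\<lambda>x. \<bar>\<bar>a i\<bar> * \<bar>x i\<bar> - \<bar>a k\<bar> * \<bar>x k\<bar>\<bar>) \<circ> (\<lambda>\<omega>. restrict (\<lambda>j. X j \<omega>) {i, k}))
        borel ((\<lambda>x. \<bar>\<Sum>j\<in>J. a j * x j\<bar>) \<circ> (\<lambda>\<omega>. restrict (\<lambda>j. X j \<omega>) J))"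
      using I J ge1 ik
      by (intro indep_var_compose[OF indep_var_restrict[OF indep, of "{i, k}" J]]) auto
    moreover have "(\<lambda>x. \<bar>\<Sum>j\<in>J. a j * x j\<bar>) \<circ> (\<lambda>\<omega>. restrict (\<lambda>j. X j \<omega>) J) = (\<lambda>\<omega>. \<bar>Y \<omega>\<bar>)"
      by (auto simp: Y_def intro!: arg_cong[where f = abs] sum.cong)
    ultimately show ?thesis by (simp add: comp_def C_def[abs_def])
  qed
  \<comment> \<open>The remaining sum is independent of the two split terms, so its absolute value
    can be replaced by the lower bound \<open>\<beta>\<close> of its mean.\<close>
  have "expectation (\<lambda>\<omega>. max (C \<omega>) \<beta>) \<le> expectation (\<lambda>\<omega>. max (C \<omega>) \<bar>Y \<omega>\<bar>)"
    using \<beta> int by (intro expectation_max_indep[OF ind]) (auto simp: Y_def[abs_def] J_def[symmetric])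
  then show ?thesis using 1 2 by (simp add: C_def algebra_simps)
qed


text \<open>This is what the split bound must supply to reach the extremal pair. For
  \<open>h\<close> at least 10 \<open>\<delta>\<close> the floor \<open>0.56 * h\<close> alone
  exceeds the left side; for smaller \<open>h\<close> the gain is the mean of the tent.\<close>

lemma near_pair_gain:
  assumes \<delta>4: "\<delta> = 1 / 10 ^ 4" and ik: "1 \<le> i" "1 \<le> k" "i \<noteq> k"
    and r: "r = 1 / sqrt 2" and x: "3 / 5 < x" "x \<le> r" and y: "3 / 5 < y" "y \<le> r"
    and h: "0 \<le> h" "h\<^sup>2 = 1 - x\<^sup>2 - y\<^sup>2"
  shows "r * mean_gap + (2 * r - x - y) * mean_abs
    \<le> expectation (\<lambda>\<omega>. max \<bar>x * \<bar>X i \<omega>\<bar> - y * \<bar>X k \<omega>\<bar>\<bar> (0.56 * h))"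
    (is "_ \<le> expectation ?f")
proof -
  define D where "D = 2 * r - x - y"
  have r2: "r\<^sup>2 = 1 / 2" by (simp add: r power_divide)
  have r_lo: "0.7 \<le> r" unfolding r by (rule power2_le_imp_le) (simp_all add: power_divide)
  have r_hi: "r \<le> 0.7072" unfolding r by (rule power2_le_imp_le) (simp_all add: power_divide)
  have D: "0 \<le> D" "1.3 * D \<le> h\<^sup>2"
    using pair_deficit[OF r2 r_lo, of x y] x y by (simp_all add: D_def h(2))
  have m: "0 \<le> mean_abs" "mean_abs \<le> 1.0001" using mean_abs_bounds \<delta>4 by simp_all
  have gap: "0 \<le> mean_gap" "mean_gap \<le> 0.0002" using mean_gap_bounds \<delta>4 by simp_all
  have int: "integrable M (X i)" "integrable M (X k)" using ik by (auto intro: integrable_X)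
  have intf: "integrable M ?f" using int by auto
  have "D * mean_abs \<le> h\<^sup>2 / 1.3 * 1.0001"
    using D m by (intro mult_mono) auto
  also have "\<dots> \<le> 77 / 100 * h\<^sup>2" by simp
  finally have Dm: "D * mean_abs \<le> 77 / 100 * h\<^sup>2" .
  show ?thesis unfolding D_def[symmetric]
  proof (cases "0.001 \<le> h")
    case True
    have "(3 / 5)\<^sup>2 \<le> x\<^sup>2" "(3 / 5)\<^sup>2 \<le> y\<^sup>2" using x y by (auto intro!: power_mono)
    \<comment> \<open>Since \<open>h\<^sup>2\<close> is at most 1 - 0.72 = 0.28, the loss
      \<open>77 / 100 * h\<^sup>2\<close> is below \<open>0.41 * h\<close>. The term with
      \<open>mean_gap\<close> is at most 0.1415 \<open>h\<close> because \<open>h\<close> is at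
      least 0.001.\<close>
    then have "h\<^sup>2 \<le> 0.53\<^sup>2" using h by (simp add: power2_eq_square)
    then have "h \<le> 0.53" by (rule power2_le_imp_le) simp
    then have "h\<^sup>2 \<le> 0.53 * h" using h unfolding power2_eq_square by (intro mult_right_mono) auto
    moreover have "r * mean_gap \<le> 0.7072 * 0.0002"
      using r_hi gap r_lo by (intro mult_mono) auto
    ultimately have "r * mean_gap + D * mean_abs \<le> 0.56 * h"
      using Dm True by (simp add: field_simps)
    also have "\<dots> = expectation (\<lambda>_. 0.56 * h)" by (simp add: prob_space)
    also have "\<dots> \<le> expectation ?f" using intf by (intro integral_mono) auto
    finally show "r * mean_gap + D * mean_abs \<le> expectation ?f" .
  next
    case False
    \<comment> \<open>Chosen so that \<open>2 * w\<close> is the floor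
      \<open>0.56 * h\<close>.\<close>
    define w where "w = 7 / 25 * h"
    let ?R = "\<lambda>\<omega>. \<bar>\<bar>X i \<omega>\<bar> - \<bar>X k \<omega>\<bar>\<bar>"
    \<comment> \<open>One copy of \<open>D * mean_abs\<close> is the deficit to be reached, the
      other pays for replacing the coefficients \<open>x\<close> and \<open>y\<close> by
      \<open>r\<close>.\<close>
    have tent: "2 * (D * mean_abs) \<le> expectation (\<lambda>\<omega>. max 0 (2 * w - r * ?R \<omega>))"
    proof (cases "h = 0")
      case True
      then have "D = 0" using D by simp
      then show ?thesis by simp
    next
      case False
      then have w: "0 < w" "w \<le> 0.00028" using h \<open>\<not> 0.001 \<le> h\<close> by (auto simp: w_def)
      \<comment> \<open>The number 24/25000 = 0.00096 bounds \<open>4 * \<delta> + 2 * w\<close>.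
        The resulting factor of \<open>h\<^sup>2\<close> is about 45.9, far above the required
        1.54.\<close>
      have "2 * (D * mean_abs) \<le> w\<^sup>2 * (9 / 16) / (24 / 25000)"
      proof -
        have w2: "w\<^sup>2 * (9 / 16) / (24 / 25000) = 49 * 15 / 16 * h\<^sup>2"
          by (simp add: w_def power_mult_distrib power_divide)
        show ?thesis unfolding w2 using Dm zero_le_power2[of h] by linarith
      qed
      also have "\<dots> \<le> w\<^sup>2 * (9 / 16) / (4 * \<delta> + 2 * w)"
        using w \<delta>4 by (intro divide_left_mono mult_pos_pos) auto
      also have "\<dots> \<le> expectation (\<lambda>\<omega>. max 0 (2 * w - r * ?R \<omega>))"
        using w r_lo r_hi by (intro expectation_gap_tent ik) auto
      finally show ?thesis .
    qed
    have "r * mean_gap + expectation (\<lambda>\<omega>. max 0 (2 * w - r * ?R \<omega>)) - D * mean_abs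
        = expectation (\<lambda>\<omega>. r * ?R \<omega> + max 0 (2 * w - r * ?R \<omega>) - ((r - x) * \<bar>X i \<omega>\<bar> + (r - y) * \<bar>X k \<omega>\<bar>))"
      using int mean_gap[OF ik] mean_abs[OF ik(1)] mean_abs[OF ik(2)]
      by (simp add: D_def algebra_simps)
    also have "\<dots> \<le> expectation ?f"
    proof (rule integral_mono)
      fix \<omega>
      define u where "u = \<bar>X i \<omega>\<bar>"
      define v where "v = \<bar>X k \<omega>\<bar>"
      have uv: "0 \<le> (r - x) * u" "0 \<le> (r - y) * v" using x y by (auto simp: u_def v_def)
      have "r * \<bar>u - v\<bar> = \<bar>r * u - r * v\<bar>" using r_lo by (simp add: abs_mult flip: right_diff_distrib)
      \<comment> \<open>The differences \<open>(r - x) * u\<close> and \<open>(r - y) * v\<close>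
        form the loss \<open>L\<close> of \<open>max_tent_le\<close>; together their mean is
        \<open>D * mean_abs\<close>.\<close>
      also have "r * u - r * v = (x * u - y * v) + (r - x) * u - (r - y) * v"
        by (simp add: algebra_simps)
      finally have "r * \<bar>u - v\<bar> \<le> \<bar>x * u - y * v\<bar> + ((r - x) * u + (r - y) * v)"
        using uv by linarith
      then have "r * \<bar>u - v\<bar> + max 0 (2 * w - r * \<bar>u - v\<bar>) - ((r - x) * u + (r - y) * v)
          \<le> max \<bar>x * u - y * v\<bar> (2 * w)"
        using uv by (intro max_tent_le) auto
      moreover have "0.56 * h = 2 * w" by (simp add: w_def)
      ultimately show "r * ?R \<omega> + max 0 (2 * w - r * ?R \<omega>) - ((r - x) * \<bar>X i \<omega>\<bar> + (r - y) * \<bar>X k \<omega>\<bar>) \<le> ?f \<omega>"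
        by (simp only: u_def v_def)
    qed (use int in auto)
    finally show "r * mean_gap + D * mean_abs \<le> expectation ?f" using tent by linarith
  qed
qed

text \<open>The case distinction is whether two coefficients exceed 3/5. If so, they are split off
  and \<open>near_pair_gain\<close> applies; otherwise Haagerup's bound leaves a fixed
  margin.\<close>

lemma expectation_abs_ge_pair:
  assumes \<delta>4: "\<delta> = 1 / 10 ^ 4" and I: "finite I" "I \<subseteq> {1..}"
    and a: "(\<Sum>j\<in>I. (a j)\<^sup>2) = 1" and sup: "\<And>j. j \<in> I \<Longrightarrow> \<bar>a j\<bar> \<le> 1 / sqrt 2"
  shows "expectation (\<lambda>\<omega>. \<bar>X 1 \<omega> + X 2 \<omega>\<bar>) / sqrt 2 \<le> expectation (\<lambda>\<omega>. \<bar>\<Sum>j\<in>I. a j * X j \<omega>\<bar>)"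
proof -
  define r where "r = 1 / sqrt 2"
  have r: "0.7 \<le> r" "r \<le> 0.7072" "r\<^sup>2 = 1 / 2"
    unfolding r_def by (rule power2_le_imp_le; simp add: power_divide)+ (simp add: power_divide)
  have target: "expectation (\<lambda>\<omega>. \<bar>X 1 \<omega> + X 2 \<omega>\<bar>) / sqrt 2 = r * mean_abs + r * mean_gap / 2"
    unfolding expectation_pair by (simp add: r_def field_simps)
  show ?thesis unfolding target
  proof (cases "\<exists>i\<in>I. \<exists>k\<in>I. i \<noteq> k \<and> 3 / 5 < \<bar>a i\<bar> \<and> 3 / 5 < \<bar>a k\<bar>")
    case True
    then obtain i k where ik: "i \<in> I" "k \<in> I" "i \<noteq> k" "3 / 5 < \<bar>a i\<bar>" "3 / 5 < \<bar>a k\<bar>" by blast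
    define J where "J = I - {i, k}"
    define h where "h = sqrt (\<Sum>j\<in>J. (a j)\<^sup>2)"
    have J: "finite J" "J \<subseteq> {1..}" using I by (auto simp: J_def)
    have "I = insert i (insert k J)" "i \<notin> insert k J" "k \<notin> J" using ik by (auto simp: J_def)
    then have "(\<Sum>j\<in>I. (a j)\<^sup>2) = (a i)\<^sup>2 + ((a k)\<^sup>2 + (\<Sum>j\<in>J. (a j)\<^sup>2))"
      using J by simp
    then have h: "0 \<le> h" "h\<^sup>2 = 1 - \<bar>a i\<bar>\<^sup>2 - \<bar>a k\<bar>\<^sup>2"
      using a by (auto simp: h_def sum_nonneg)
    have "9 / 16 * h - \<delta> * h \<le> expectation (\<lambda>\<omega>. \<bar>\<Sum>j\<in>J. a j * X j \<omega>\<bar>)"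
      using sign_avg_abs_ge[OF J(1), of a] expectation_abs_ge_sign_avg[OF J, of a]
      unfolding h_def by linarith
    \<comment> \<open>The constant is 9/16 = 0.5625 rounded down to absorb
      \<open>\<delta>\<close>.\<close>
    moreover have "0.56 * h \<le> 9 / 16 * h - \<delta> * h" using h unfolding \<delta>4 by simp
    ultimately have "0.56 * h \<le> expectation (\<lambda>\<omega>. \<bar>\<Sum>j\<in>I - {i, k}. a j * X j \<omega>\<bar>)"
      by (simp add: J_def)
    from expectation_abs_split[OF I ik(1-3) this]
    have "((\<bar>a i\<bar> + \<bar>a k\<bar>) * mean_abs + expectation (\<lambda>\<omega>. max \<bar>\<bar>a i\<bar> * \<bar>X i \<omega>\<bar> - \<bar>a k\<bar> * \<bar>X k \<omega>\<bar>\<bar> (0.56 * h))) / 2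
      \<le> expectation (\<lambda>\<omega>. \<bar>\<Sum>j\<in>I. a j * X j \<omega>\<bar>)" .
    moreover have "r * mean_gap + (2 * r - \<bar>a i\<bar> - \<bar>a k\<bar>) * mean_abs
        \<le> expectation (\<lambda>\<omega>. max \<bar>\<bar>a i\<bar> * \<bar>X i \<omega>\<bar> - \<bar>a k\<bar> * \<bar>X k \<omega>\<bar>\<bar> (0.56 * h))"
      using I ik sup[of i] sup[of k] h by (intro near_pair_gain[OF \<delta>4 _ _ _ r_def]) (auto simp: r_def)
    ultimately show "r * mean_abs + r * mean_gap / 2 \<le> expectation (\<lambda>\<omega>. \<bar>\<Sum>j\<in>I. a j * X j \<omega>\<bar>)"
      by (simp add: algebra_simps)
  next
    case False
    obtain i where i: "i \<in> I" "\<And>j. j \<in> I \<Longrightarrow> j \<noteq> i \<Longrightarrow> \<bar>a j\<bar> \<le> 3 / 5"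
    proof (cases "\<exists>i\<in>I. 3 / 5 < \<bar>a i\<bar>")
      case True
      then obtain i where i: "i \<in> I" "3 / 5 < \<bar>a i\<bar>" by blast
      show ?thesis
      proof (rule that[OF i(1)])
        fix j assume "j \<in> I" "j \<noteq> i"
        then show "\<bar>a j\<bar> \<le> 3 / 5" using False i by (meson not_le)
      qed
    next
      case no: False
      have "I \<noteq> {}" using a by auto
      then obtain i where i: "i \<in> I" by blast
      show ?thesis
      proof (rule that[OF i])
        fix j assume "j \<in> I"
        then show "\<bar>a j\<bar> \<le> 3 / 5" using no by (meson not_le)
      qed
    qed
    have "\<bar>a i\<bar>\<^sup>2 \<le> r\<^sup>2" using sup[OF i(1)] unfolding r_def by (intro power_mono) auto
    then have "0.712 \<le> sign_avg I a abs"
      using r by (intro sign_avg_abs_far[OF I(1) a i(1) _ i(2)]) auto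
    then have "0.712 - \<delta> \<le> expectation (\<lambda>\<omega>. \<bar>\<Sum>j\<in>I. a j * X j \<omega>\<bar>)"
      using expectation_abs_ge_sign_avg[OF I, of a] by (simp add: a)
    \<comment> \<open>The target is at most 0.7072 * 1.0002, about 0.7074, against 0.712 - 0.0001
      from below.\<close>
    moreover have "r * mean_abs \<le> 0.7072 * (1 + \<delta>)" "r * mean_gap \<le> 0.7072 * (2 * \<delta>)"
      by (rule mult_mono; use r \<delta> mean_abs_bounds mean_gap_bounds in simp)+
    ultimately show "r * mean_abs + r * mean_gap / 2 \<le> expectation (\<lambda>\<omega>. \<bar>\<Sum>j\<in>I. a j * X j \<omega>\<bar>)"
      using \<delta>4 by simp
  qed
qed

end

theorem theorem1:
  "(\<exists>\<delta>\<^sub>0>0. admissible_constant TYPE('a) \<delta>\<^sub>0) \<and> admissible_constant TYPE('a) (1 / 10 ^ 4)"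
proof -
  have "admissible_constant TYPE('a) (1 / 10 ^ 4)"
    unfolding admissible_constant_def
  proof (intro allI impI)
    fix M :: "'a measure" and X :: "nat \<Rightarrow> 'a \<Rightarrow> real" and n a
    assume "prob_space M" and iid: "iid_seq M X" and sym: "symmetric_rv M (X 1)"
      and L2: "L2_norm_le M (\<lambda>\<omega>. \<bar>X 1 \<omega>\<bar> - 1) (1 / 10 ^ 4)"
      and n: "3 \<le> n" and a: "unit_vec n a" and sup: "sup_norm n a \<le> 1 / sqrt 2"
    interpret prob_space M by fact
    have L2': "integrable M (\<lambda>\<omega>. (\<bar>X 1 \<omega>\<bar> - 1)\<^sup>2)"
      "sqrt (expectation (\<lambda>\<omega>. (\<bar>X 1 \<omega>\<bar> - 1)\<^sup>2)) \<le> 1 / 10 ^ 4"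
      using L2 by (auto simp: L2_norm_le_def L2_norm_def)
    interpret near_sign_sequence M X "1 / 10 ^ 4"
    proof unfold_locales
      show "expectation (\<lambda>\<omega>. (\<bar>X 1 \<omega>\<bar> - 1)\<^sup>2) \<le> (1 / 10 ^ 4)\<^sup>2"
        using L2'(2) by (rule sqrt_le_D)
      show "indep_vars (\<lambda>_. borel) X {1..}"
        using iid unfolding iid_seq_def by blast
      show "distr M borel (X j) = distr M borel (X 1)" if "1 \<le> j" for j
        using iid that unfolding iid_seq_def by blast
      show "distr M borel (\<lambda>\<omega>. - X 1 \<omega>) = distr M borel (X 1)"
        using sym unfolding symmetric_rv_def by blast
      show "integrable M (\<lambda>\<omega>. (\<bar>X 1 \<omega>\<bar> - 1)\<^sup>2)" by (rule L2'(1))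
    qed simp
    have "\<bar>a j\<bar> \<le> 1 / sqrt 2" if "j \<in> {1..n}" for j
    proof -
      have "\<bar>a j\<bar> \<le> sup_norm n a" unfolding sup_norm_def using that by (intro Max_ge) auto
      then show ?thesis using sup by linarith
    qed
    then have "expectation (\<lambda>\<omega>. \<bar>X 1 \<omega> + X 2 \<omega>\<bar>) / sqrt 2 \<le> expectation (\<lambda>\<omega>. \<bar>\<Sum>j=1..n. a j * X j \<omega>\<bar>)"
      using a by (intro expectation_abs_ge_pair) (auto simp: unit_vec_def)
    then show "expectation (\<lambda>\<omega>. \<bar>(X 1 \<omega> + X 2 \<omega>) / sqrt 2\<bar>) \<le> expectation (\<lambda>\<omega>. \<bar>\<Sum>j=1..n. a j * X j \<omega>\<bar>)"
      by (simp add: abs_divide)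
  qed
  then show ?thesis by (intro conjI exI[of _ "1 / 10 ^ 4"]) auto
qed

end
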